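(* Let $T>0$, $0<p,q\le\infty$, and let $A:\Delta_2(0,T)\to\mathbb R^m$ be measurable. Let $\omega:[0,\infty)\to[0,\infty)$ be non-decreasing with $\lim_{r\to0^+}\omega(r)=0$ and $\omega(2\tau)\lesssim\omega(\tau)$ for all $\tau>0$, and suppose that $$\zeta(\tau):=\Big(\frac{\omega(\tau)}{\tau^{1/p}}\Big)^{1\wedge p}\quad\text{satisfies}\quad\int_0^S\zeta(h)\frac{dh}h\le K\zeta(S)\ \text{ for some }K>0\text{ and all }S>0 .$$ Assume $\|A\|_{\mathbb B^\omega_{pq}([0,T])}<\infty$ and that, for some $\theta\in(0,1/2]$ and $M>0$, and all $0\le s\le u\le t\le T$, $$|\delta A_{sut}|\le M\,\zeta\Big(\big((u-s)\wedge(t-u)\big)^\theta\big((u-s)\vee(t-u)\big)^{1-\theta}\Big)^{1\vee\frac1p}.$$ Then there exists a continuous version of $A$, denoted also by $A$, such that $$\sup_{0\le s<t\le T}\frac{|A_{st}|}{\omega(t-s)(t-s)^{-1/p}}\lesssim_{K,p,q,\theta}\|A\|_{\mathbb B^\omega_{pq}([0,T])}+M .$$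
   Context: $\Delta_2(0,T)=\{(s,t)\in[0,T]^2:s\le t\}$; $\delta A_{sut}=A_{st}-A_{su}-A_{ut}$. $\Omega_p(A,\tau)=\sup_{0\le h\le\tau}\big(\int_0^{T-h}|A_{r,r+h}|^p\,dr\big)^{1/p}$ and $\|A\|_{\mathbb B^\omega_{pq}([0,T])}=\big[\int_0^T(\Omega_p(A,\tau)/\omega(\tau))^q\frac{d\tau}\tau\big]^{1/q}$ (suprema when an exponent is $\infty$; $1/\infty=0$). $\lesssim_{a,\dots}$: up to a constant depending only on $a,\dots$ and on the constant in the doubling condition $\omega(2\tau)\lesssim\omega(\tau)$. *)

theory Defs
  imports "HOL-Probability.Essential_Supremum"
begin

definition Delta2 :: "real \<Rightarrow> (real \<times> real) set" where
  "Delta2 T = {(s, t). 0 \<le> s \<and> s \<le> t \<and> t \<le> T}"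

text \<open>
  The dimension \<open>m\<close> of the target space is a variable, so that constants can be required not to
  depend on it: vectors of \<open>\<real>\<^sup>m\<close> are the elements of \<open>topspace (Euclidean_space m)\<close>, i.e. sequences
  whose entries with index \<open>\<ge> m\<close> vanish.
\<close>

definition vec_norm :: "nat \<Rightarrow> (nat \<Rightarrow> real) \<Rightarrow> real" where
  "vec_norm m x = L2_set x {..<m}"

definition delta :: "(real \<times> real \<Rightarrow> nat \<Rightarrow> real) \<Rightarrow> real \<Rightarrow> real \<Rightarrow> real \<Rightarrow> nat \<Rightarrow> real" where
  "delta A s u t = (\<lambda>i. A (s, t) i - A (s, u) i - A (u, t) i)"

text \<open>Real powers with values in \<open>[0, \<infinity>]\<close>; only used for exponents \<open>a > 0\<close>.\<close>

definition epowr :: "ennreal \<Rightarrow> real \<Rightarrow> ennreal" where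
  "epowr x a = (if x = \<infinity> then \<infinity> else ennreal (enn2real x powr a))"

definition Lp_qnorm :: "ennreal \<Rightarrow> 'a measure \<Rightarrow> ('a \<Rightarrow> ennreal) \<Rightarrow> ennreal" where
  "Lp_qnorm p N f =
     (if p = \<infinity> then esssup N f
      else epowr (\<integral>\<^sup>+x. epowr (f x) (enn2real p) \<partial>N) (1 / enn2real p))"

definition Omega ::
  "nat \<Rightarrow> real \<Rightarrow> ennreal \<Rightarrow> (real \<times> real \<Rightarrow> nat \<Rightarrow> real) \<Rightarrow> real \<Rightarrow> ennreal" where
  "Omega m T p A \<tau> =
     (SUP h\<in>{0..\<tau>}. Lp_qnorm p (restrict_space lborel {0..T - h})
                        (\<lambda>r. ennreal (vec_norm m (A (r, r + h)))))"

text \<open>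
  The outer measure is \<open>d\<tau>/\<tau>\<close> on \<open>(0, T]\<close>. The quotient is taken in \<open>[0, \<infinity>]\<close>, so for
  \<open>\<omega>(\<tau>) = 0\<close> it is \<open>\<infinity>\<close> unless the numerator vanishes, in which case it is \<open>0\<close>.
\<close>

definition besov_qnorm ::
  "nat \<Rightarrow> real \<Rightarrow> ennreal \<Rightarrow> ennreal \<Rightarrow> (real \<Rightarrow> real) \<Rightarrow> (real \<times> real \<Rightarrow> nat \<Rightarrow> real) \<Rightarrow> ennreal" where
  "besov_qnorm m T p q \<omega> A =
     Lp_qnorm q (density (restrict_space lborel {0<..T}) (\<lambda>\<tau>. ennreal (1 / \<tau>)))
       (\<lambda>\<tau>. Omega m T p A \<tau> / ennreal (\<omega> \<tau>))"

text \<open>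
  In \<^typ>\<open>ennreal\<close> one has \<open>1 / \<infinity> = 0\<close>. At \<open>\<tau> = 0\<close>, where the quotient is not defined, the
  conventions \<open>x / 0 = 0\<close> and \<open>0 powr a = 0\<close> give \<open>zeta p \<omega> 0 = 0\<close>. This is the limit at \<open>0\<^sup>+\<close>
  under the integral condition on \<open>zeta\<close> and monotonicity and doubling of \<open>\<omega>\<close>.
\<close>

definition zeta :: "ennreal \<Rightarrow> (real \<Rightarrow> real) \<Rightarrow> real \<Rightarrow> real" where
  "zeta p \<omega> \<tau> = (\<omega> \<tau> / \<tau> powr enn2real (1 / p)) powr enn2real (min 1 p)"

end

theory Submission
  imports Defs
begin

text \<open>
  Monotonicity of \<open>\<omega>\<close> and the integral condition make \<open>\<phi>(\<tau>) = \<omega>(\<tau>) \<tau>\<^bsup>-1/p\<^esup>\<close> almost increasing and give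
  \<open>\<Sum>\<^sub>n \<phi>(\<tau>/2\<^sup>n) \<lesssim> \<phi>(\<tau>)\<close>. The Besov norm enters only through a weak-type estimate: at scale \<open>\<tau>\<close>
  and for \<open>h \<le> \<tau>\<close>, the inequality \<open>|A(r, r + h)| \<lesssim> \<phi>(\<tau>)\<close> fails on a set of \<open>r\<close> of measure at
  most \<open>\<tau>/128\<close>. By Fubini, most pairs at distance at most \<open>\<tau>\<close> are good, so that almost every \<open>s\<close> can
  be joined to most \<open>u\<close> with \<open>u - s \<approx> \<tau>\<close> by a chain of good links of lengths
  \<open>\<dots>, \<tau>/4, \<tau>/2, \<tau>\<close>; Borel--Cantelli provides the start of the chain near \<open>s\<close>. A link at
  scale \<open>\<tau>/2\<^sup>n\<close> costs \<open>\<phi>(\<tau>/2\<^sup>n)\<close>, including the defect of additivity, and the sum converges.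
  Meeting in the middle from \<open>s\<close> and from \<open>t\<close> bounds \<open>|A(s, t)|\<close> for all \<open>s < t\<close> in a set of full measure.
  The exponent \<open>\<theta>\<close> matters only for the uniform continuity of \<open>A\<close> on that set, hence for its
  continuous extension.
\<close>

section \<open>Reflections, null sets and dyadic scales on the real line\<close>

lemma emeasure_lborel_reflect:
  fixes c :: real
  assumes [measurable]: "S \<in> sets borel"
  shows "emeasure lborel {x. c - x \<in> S} = emeasure lborel S"
proof -
  have "emeasure lborel S = (\<integral>\<^sup>+x. indicator S x \<partial>lborel)"
    by simp
  also have "\<dots> = (\<integral>\<^sup>+x. indicator S (c + (-1) * x) \<partial>lborel)"
    by (subst nn_integral_real_affine[where c = "-1" and t = c]) auto
  also have "\<dots> = (\<integral>\<^sup>+x. indicator {x. c - x \<in> S} x \<partial>lborel)"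
    by (intro nn_integral_cong) (auto simp: indicator_def)
  also have "\<dots> = emeasure lborel {x. c - x \<in> S}"
    by (intro nn_integral_indicator) measurable
  finally show ?thesis
    by simp
qed

lemma AE_lborel_reflect:
  fixes c :: real
  assumes "AE x in lborel. P x"
  shows "AE x in lborel. P (c - x)"
proof -
  obtain N where N: "\<And>x. x \<notin> N \<Longrightarrow> P x" "N \<in> null_sets lborel"
    using AE_E3[OF assms] by auto
  have [measurable]: "N \<in> sets borel"
    using N(2) by auto
  have "AE x in lborel. x \<notin> N"
    using N(2) by (rule AE_not_in)
  then have "AE x in lborel. c + (-1) * x \<notin> N"
    by (intro AE_borel_affine) auto
  then show ?thesis
    by eventually_elim (auto intro: N)
qed

lemma AE_lborel_dense:
  fixes a b :: real
  assumes "AE x in lborel. P x" and "a < b"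
  obtains x where "a < x" "x < b" "P x"
proof -
  have "\<exists>x. x \<in> {a<..<b} \<and> P x"
  proof (rule ccontr)
    assume "\<not> ?thesis"
    then have "AE x in lborel. x \<notin> {a<..<b}"
      using assms(1) by (elim eventually_mono) auto
    then have "{a<..<b} \<in> null_sets lborel"
      by (subst (asm) AE_iff_null_sets[symmetric]) auto
    then show False
      using assms(2) by (auto simp: null_sets_def)
  qed
  then show ?thesis
    using that by auto
qed

text \<open>Halve \<open>y\<close> until it first drops to at most \<open>2 * x\<close>. This cannot
  undershoot \<open>x\<close>, because every halved value comes from one exceeding
  \<open>2 * x\<close>.\<close>

lemma dyadic_bracket:
  fixes x y :: real
  assumes "0 < x" "x \<le> y"
  obtains n where "x \<le> y / 2 ^ n" "y / 2 ^ n \<le> 2 * x"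
proof -
  obtain N where "y / x < 2 ^ N"
    using real_arch_pow[of 2 "y / x"] by auto
  then have "y \<le> 2 ^ N * x"
    using assms by (simp add: field_simps)
  then have "\<exists>n. x \<le> y / 2 ^ n \<and> y / 2 ^ n \<le> 2 * x"
    using assms(2)
  proof (induction N arbitrary: y)
    case 0
    then show ?case
      using assms(1) by (intro exI[of _ 0]) auto
  next
    case (Suc N)
    show ?case
    proof (cases "y \<le> 2 * x")
      case True
      then show ?thesis
        using Suc.prems by (intro exI[of _ 0]) auto
    next
      case False
      then obtain n where "x \<le> y / 2 / 2 ^ n" "y / 2 / 2 ^ n \<le> 2 * x"
        using Suc.IH[of "y / 2"] Suc.prems by auto
      then show ?thesis
        by (intro exI[of _ "Suc n"]) auto
    qed
  qed
  then show ?thesis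
    using that by blast
qed

subsection \<open>Almost subadditive functions under weak-type bounds\<close>

text \<open>In the application \<open>a\<close> is the norm of \<open>A\<close> extended by zero,
  \<Phi> is a multiple of the weight and \<open>T0 = T / 2\<close>. One constant \<open>c\<close>
  serves both almost monotonicity and dyadic summability. The fraction 1/128 = 1/16 * 1/8 is what
  lets the exceptional measure \<tau>/8 reproduce itself when the scale doubles.\<close>

locale almost_subadditive =
  fixes a :: "real \<times> real \<Rightarrow> real" and \<Phi> :: "real \<Rightarrow> real" and T T0 c :: real
  assumes T0: "0 < T0" "T0 \<le> T"
    and meas [measurable]: "a \<in> borel_measurable borel"
    and off: "(s, t) \<notin> Delta2 T \<Longrightarrow> a (s, t) = 0"
    and nonneg: "0 < \<tau> \<Longrightarrow> 0 \<le> \<Phi> \<tau>"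
    and almost_mono: "0 < \<sigma> \<Longrightarrow> \<sigma> \<le> \<tau> \<Longrightarrow> \<Phi> \<sigma> \<le> c * \<Phi> \<tau>"
    and dyadic_sum: "0 < \<tau> \<Longrightarrow> (\<Sum>n<N. \<Phi> (\<tau> / 2 ^ n)) \<le> c * \<Phi> \<tau>"
    and c_pos: "0 < c"
    and subadd: "0 \<le> s \<Longrightarrow> s \<le> u \<Longrightarrow> u \<le> t \<Longrightarrow> t \<le> T \<Longrightarrow> s < t \<Longrightarrow>
      a (s, t) \<le> a (s, u) + a (u, t) + \<Phi> (t - s)"
    and weak: "0 < \<tau> \<Longrightarrow> \<tau> \<le> T0 \<Longrightarrow> h \<le> \<tau> \<Longrightarrow>
      emeasure lborel {r. \<Phi> \<tau> < a (r, r + h)} \<le> ennreal (\<tau> / 128)"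
begin

section \<open>The set of bad pairs at a given scale and the size of its sections\<close>

definition bad :: "real \<Rightarrow> (real \<times> real) set" where
  "bad \<tau> = {(u, v). v - u \<le> \<tau> \<and> \<Phi> \<tau> < a (u, v)}"

lemma bad_measurable [measurable]: "bad \<tau> \<in> sets borel"
proof -
  have [measurable]: "fst \<in> borel_measurable (borel :: (real \<times> real) measure)"
      "snd \<in> borel_measurable (borel :: (real \<times> real) measure)"
    by (intro borel_measurable_continuous_onI continuous_intros)+
  have "bad \<tau> = {z. snd z - fst z \<le> \<tau> \<and> \<Phi> \<tau> < a z}"
    by (auto simp: bad_def)
  then show ?thesis
    by simp
qed

text \<open>Outside the simplex \<open>a\<close> vanishes and so cannot exceed the nonnegative
  level. This confines \<open>v - u\<close> to \<open>{0..\<tau>}\<close> for bad pairs.\<close>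

lemma bad_le: "0 < \<tau> \<Longrightarrow> (u, v) \<in> bad \<tau> \<Longrightarrow> u \<le> v"
  using off[of u v] nonneg[of \<tau>] by (auto simp: bad_def Delta2_def)

text \<open>Fubini in the coordinates \<open>u\<close> and \<open>h = v - u\<close>: for each
  \<open>h\<close> in \<open>{0..\<tau>}\<close> the slice has measure at most \<tau>/128 by
  \<open>weak\<close>, and all other slices are empty.\<close>

lemma nn_integral_bad:
  assumes \<tau>: "0 < \<tau>" "\<tau> \<le> T0"
  shows "(\<integral>\<^sup>+u. (\<integral>\<^sup>+v. indicator (bad \<tau>) (u, v) \<partial>lborel) \<partial>lborel) \<le> ennreal (\<tau>\<^sup>2 / 128)"
proof -
  have "(\<integral>\<^sup>+u. (\<integral>\<^sup>+v. indicator (bad \<tau>) (u, v) \<partial>lborel) \<partial>lborel)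
      = (\<integral>\<^sup>+u. (\<integral>\<^sup>+h. indicator (bad \<tau>) (u, u + h) \<partial>lborel) \<partial>lborel)"
  proof (rule nn_integral_cong)
    fix u
    show "(\<integral>\<^sup>+v. indicator (bad \<tau>) (u, v) \<partial>lborel)
        = (\<integral>\<^sup>+h. indicator (bad \<tau>) (u, u + h) \<partial>lborel)"
      using nn_integral_real_affine[of "\<lambda>v. indicator (bad \<tau>) (u, v)" 1 u] by simp
  qed
  also have "\<dots> = (\<integral>\<^sup>+h. (\<integral>\<^sup>+u. indicator (bad \<tau>) (u, u + h) \<partial>lborel) \<partial>lborel)"
    by (rule lborel_pair.Fubini'[symmetric]) measurable
  also have "\<dots> \<le> (\<integral>\<^sup>+h. ennreal (\<tau> / 128) * indicator {0..\<tau>} h \<partial>lborel)"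
  proof (intro nn_integral_mono)
    fix h :: real
    have "(\<integral>\<^sup>+u. indicator (bad \<tau>) (u, u + h) \<partial>lborel)
        = (\<integral>\<^sup>+u. indicator {u. (u, u + h) \<in> bad \<tau>} u \<partial>lborel)"
      by (intro nn_integral_cong) (auto simp: indicator_def)
    also have "\<dots> = emeasure lborel {u. (u, u + h) \<in> bad \<tau>}"
      by (intro nn_integral_indicator) measurable
    also have "\<dots> \<le> ennreal (\<tau> / 128) * indicator {0..\<tau>} h"
    proof (cases "h \<in> {0..\<tau>}")
      case True
      have "emeasure lborel {u. (u, u + h) \<in> bad \<tau>} \<le> emeasure lborel {u. \<Phi> \<tau> < a (u, u + h)}"
        by (intro emeasure_mono) (auto simp: bad_def)
      also have "\<dots> \<le> ennreal (\<tau> / 128)"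
        using True \<tau> by (intro weak) auto
      finally show ?thesis
        using True by simp
    next
      case False
      have "(u, u + h) \<notin> bad \<tau>" for u
      proof
        assume *: "(u, u + h) \<in> bad \<tau>"
        have "u \<le> u + h"
          using \<tau>(1) * by (rule bad_le)
        moreover have "u + h - u \<le> \<tau>"
          using * by (simp add: bad_def)
        ultimately show False
          using False by simp
      qed
      then show ?thesis
        by simp
    qed
    finally show "(\<integral>\<^sup>+u. indicator (bad \<tau>) (u, u + h) \<partial>lborel)
        \<le> ennreal (\<tau> / 128) * indicator {0..\<tau>} h" .
  qed
  also have "\<dots> = ennreal (\<tau>\<^sup>2 / 128)"
    using \<tau> by (simp add: nn_integral_cmult_indicator ennreal_mult[symmetric] power2_eq_square)
  finally show ?thesis .
qed

lemma emeasure_bad_section: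
  "emeasure lborel {v. (u, v) \<in> bad \<tau>} = (\<integral>\<^sup>+v. indicator (bad \<tau>) (u, v) \<partial>lborel)"
  "emeasure lborel {v. (v, u) \<in> bad \<tau>} = (\<integral>\<^sup>+v. indicator (bad \<tau>) (v, u) \<partial>lborel)"
proof -
  have "emeasure lborel {v. (u, v) \<in> bad \<tau>}
      = (\<integral>\<^sup>+v. indicator {v. (u, v) \<in> bad \<tau>} v \<partial>lborel)"
    by (intro nn_integral_indicator[symmetric]) measurable
  then show "emeasure lborel {v. (u, v) \<in> bad \<tau>} = (\<integral>\<^sup>+v. indicator (bad \<tau>) (u, v) \<partial>lborel)"
    by (simp add: indicator_def)
  have "emeasure lborel {v. (v, u) \<in> bad \<tau>}
      = (\<integral>\<^sup>+v. indicator {v. (v, u) \<in> bad \<tau>} v \<partial>lborel)"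
    by (intro nn_integral_indicator[symmetric]) measurable
  then show "emeasure lborel {v. (v, u) \<in> bad \<tau>} = (\<integral>\<^sup>+v. indicator (bad \<tau>) (v, u) \<partial>lborel)"
    by (simp add: indicator_def)
qed

lemma section_measurable [measurable]:
  "(\<lambda>u. emeasure lborel {v. (u, v) \<in> bad \<tau>}) \<in> borel_measurable borel"
  "(\<lambda>u. emeasure lborel {v. (v, u) \<in> bad \<tau>}) \<in> borel_measurable borel"
  unfolding emeasure_bad_section by measurable

text \<open>Markov's inequality for the section measures, whose integral is at most \<tau>^2/128 in
  either order of integration; the threshold \<tau>/k gives k\<tau>/128. The first bound serves the
  start of a chain through Borel-Cantelli, the second its links.\<close>

lemma emeasure_large_sections:
  assumes \<tau>: "0 < \<tau>" "\<tau> \<le> T0"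
  shows "emeasure lborel {u. ennreal (\<tau> / 32) \<le> emeasure lborel {v. (u, v) \<in> bad \<tau>}} \<le> ennreal (\<tau> / 4)"
    and "emeasure lborel {u. ennreal (\<tau> / 16) \<le> emeasure lborel {v. (v, u) \<in> bad \<tau>}} \<le> ennreal (\<tau> / 8)"
proof -
  have markov: "emeasure lborel {u. ennreal (\<tau> / k) \<le> F u} \<le> ennreal (k * \<tau> / 128)"
    if "0 < k" and [measurable]: "F \<in> borel_measurable borel"
      and F: "(\<integral>\<^sup>+u. F u \<partial>lborel) \<le> ennreal (\<tau>\<^sup>2 / 128)" for k and F :: "real \<Rightarrow> ennreal"
  proof -
    have "{u \<in> space lborel. 1 \<le> ennreal (k / \<tau>) * F u} = {u. ennreal (\<tau> / k) \<le> F u}"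
    proof -
      have "1 \<le> ennreal (k / \<tau>) * y \<longleftrightarrow> ennreal (\<tau> / k) \<le> y" for y
        using that(1) \<tau> by (cases y)
          (auto simp: ennreal_mult[symmetric] ennreal_mult_top ennreal_1[symmetric] field_simps
            simp del: ennreal_1)
      then show ?thesis
        by auto
    qed
    then have "emeasure lborel {u. ennreal (\<tau> / k) \<le> F u} \<le> ennreal (k / \<tau>) * (\<integral>\<^sup>+u. F u \<partial>lborel)"
      using nn_integral_Markov_inequality[of "\<lambda>u. F u" UNIV lborel "ennreal (k / \<tau>)"] by simp
    also have "\<dots> \<le> ennreal (k / \<tau>) * ennreal (\<tau>\<^sup>2 / 128)"
      by (intro mult_left_mono F) auto
    also have "\<dots> = ennreal (k * \<tau> / 128)"
      using that(1) \<tau> by (simp add: ennreal_mult[symmetric] power2_eq_square)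
    finally show ?thesis .
  qed
  show "emeasure lborel {u. ennreal (\<tau> / 32) \<le> emeasure lborel {v. (u, v) \<in> bad \<tau>}} \<le> ennreal (\<tau> / 4)"
    using markov[of 32 "\<lambda>u. emeasure lborel {v. (u, v) \<in> bad \<tau>}"] nn_integral_bad[OF \<tau>]
    by (simp add: emeasure_bad_section)
  have "(\<integral>\<^sup>+u. (\<integral>\<^sup>+v. indicator (bad \<tau>) (v, u) \<partial>lborel) \<partial>lborel)
      = (\<integral>\<^sup>+u. (\<integral>\<^sup>+v. indicator (bad \<tau>) (u, v) \<partial>lborel) \<partial>lborel)"
    by (rule lborel_pair.Fubini') measurable
  then show "emeasure lborel {u. ennreal (\<tau> / 16) \<le> emeasure lborel {v. (v, u) \<in> bad \<tau>}} \<le> ennreal (\<tau> / 8)"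
    using markov[of 16 "\<lambda>u. emeasure lborel {v. (v, u) \<in> bad \<tau>}"] nn_integral_bad[OF \<tau>]
    by (simp add: emeasure_bad_section)
qed

section \<open>Chains of good links starting near almost every point\<close>

definition regular :: "real \<Rightarrow> bool" where
  "regular s \<longleftrightarrow> (\<forall>\<^sub>F n in sequentially.
     emeasure lborel {v. (s, v) \<in> bad (T0 / 2 ^ n)} < ennreal (T0 / 2 ^ n / 32))"

text \<open>Borel-Cantelli: at scale \<open>T0 / 2 ^ n\<close> the exceptional set has measure at
  most a quarter of the scale, which is summable in \<open>n\<close>.\<close>

lemma AE_regular: "AE s in lborel. regular s"
proof -
  define E where "E n = {u. ennreal (T0 / 2 ^ n / 32) \<le> emeasure lborel {v. (u, v) \<in> bad (T0 / 2 ^ n)}}" for n :: nat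
  have E: "emeasure lborel (E n) \<le> ennreal (T0 / 2 ^ n / 4)" for n
    unfolding E_def using T0 by (intro emeasure_large_sections) (auto simp: field_simps)
  have "measure lborel (E n) \<le> (T0 / 4) * (1 / 2) ^ n" for n
  proof -
    have "measure lborel (E n) \<le> T0 / 2 ^ n / 4"
      using E[of n] T0 unfolding measure_def by (intro enn2real_leI) auto
    then show ?thesis
      by (simp add: power_one_over)
  qed
  then have "summable (\<lambda>n. measure lborel (E n))"
    by (intro summable_comparison_test'[OF summable_mult[OF summable_geometric[of "1 / 2"]], of 0 _ "T0 / 4"]) auto
  moreover have "emeasure lborel (E n) < \<infinity>" for n
    using E[of n] by (auto intro: le_less_trans)
  moreover have "E n \<in> sets lborel" for n
    unfolding E_def by measurable
  ultimately have "AE s in lborel. \<forall>\<^sub>F n in sequentially. s \<in> space lborel - E n"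
    by (intro borel_cantelli_AE1) auto
  then show ?thesis
    by eventually_elim (auto simp: regular_def E_def not_le elim!: eventually_mono)
qed

text \<open>
  The link \<open>v\<close> between \<open>s\<close> and \<open>u\<close> exists because the points excluded in \<open>[s + \<tau>/4, s + \<tau>/2]\<close>
  have measure less than \<open>\<tau>/8\<close>.
\<close>

lemma halving_step:
  assumes \<tau>: "0 < \<tau>" "\<tau> \<le> T0" and s: "0 \<le> s" "s + \<tau> \<le> T"
    and half: "emeasure lborel {v\<in>{s + \<tau> / 4..s + \<tau> / 2}. \<alpha> < a (s, v)} \<le> ennreal (\<tau> / 16)"
  shows "emeasure lborel {u\<in>{s + \<tau> / 2..s + \<tau>}. \<alpha> + (1 + c) * \<Phi> \<tau> < a (s, u)} \<le> ennreal (\<tau> / 8)"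
proof -
  have "a (s, u) \<le> \<alpha> + (1 + c) * \<Phi> \<tau>"
    if u: "u \<in> {s + \<tau> / 2..s + \<tau>}"
      and *: "emeasure lborel {v. (v, u) \<in> bad \<tau>} < ennreal (\<tau> / 16)" for u
  proof -
    let ?I = "{s + \<tau> / 4..s + \<tau> / 2}"
    have "\<not> ?I \<subseteq> {v\<in>?I. \<alpha> < a (s, v)} \<union> {v. (v, u) \<in> bad \<tau>}"
    proof
      assume "?I \<subseteq> {v\<in>?I. \<alpha> < a (s, v)} \<union> {v. (v, u) \<in> bad \<tau>}"
      then have "emeasure lborel ?I \<le> emeasure lborel ({v\<in>?I. \<alpha> < a (s, v)} \<union> {v. (v, u) \<in> bad \<tau>})"
        by (intro emeasure_mono) measurable
      also have "\<dots> \<le> emeasure lborel {v\<in>?I. \<alpha> < a (s, v)} + emeasure lborel {v. (v, u) \<in> bad \<tau>}"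
        by (intro emeasure_subadditive) measurable
      also have "\<dots> \<le> ennreal (\<tau> / 16) + emeasure lborel {v. (v, u) \<in> bad \<tau>}"
        using half by (rule add_right_mono)
      also have "\<dots> < ennreal (\<tau> / 16) + ennreal (\<tau> / 16)"
        using * by (simp add: ennreal_add_left_cancel_less)
      also have "\<dots> = ennreal (\<tau> / 8)"
        using \<tau> by (simp add: ennreal_plus[symmetric] del: ennreal_plus)
      finally show False
        using \<tau> by (simp add: ennreal_less_iff)
    qed
    then obtain v where v: "v \<in> ?I" "a (s, v) \<le> \<alpha>" "(v, u) \<notin> bad \<tau>"
      by force
    \<comment> \<open>Since \<open>u - v \<le> \<tau>\<close>, the pair can fail to be bad only
      through the value of \<open>a\<close>.\<close>
    have "a (v, u) \<le> \<Phi> \<tau>"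
      using v u \<tau> by (auto simp: bad_def)
    moreover have "a (s, u) \<le> a (s, v) + a (v, u) + \<Phi> (u - s)"
      using v u \<tau> s by (intro subadd) auto
    moreover have "\<Phi> (u - s) \<le> c * \<Phi> \<tau>"
      using u \<tau> by (intro almost_mono) auto
    ultimately show ?thesis
      using v by (simp add: algebra_simps)
  qed
  then have "{u\<in>{s + \<tau> / 2..s + \<tau>}. \<alpha> + (1 + c) * \<Phi> \<tau> < a (s, u)}
      \<subseteq> {u. ennreal (\<tau> / 16) \<le> emeasure lborel {v. (v, u) \<in> bad \<tau>}}"
    by (force simp: not_less)
  then have "emeasure lborel {u\<in>{s + \<tau> / 2..s + \<tau>}. \<alpha> + (1 + c) * \<Phi> \<tau> < a (s, u)}
      \<le> emeasure lborel {u. ennreal (\<tau> / 16) \<le> emeasure lborel {v. (v, u) \<in> bad \<tau>}}"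
    by (intro emeasure_mono) measurable
  also have "\<dots> \<le> ennreal (\<tau> / 8)"
    using \<tau> by (rule emeasure_large_sections)
  finally show ?thesis .
qed

text \<open>Induction on \<open>n\<close> with \<tau> varying: the statement at scale \<tau>/2 has
  exceptional measure \<tau>/16, exactly what \<open>halving_step\<close> requires to pass to scale
  \<tau>. Each step adds the cost \<open>(1 + c) * \<Phi>\<close> of one link at its scale, and for
  \<open>n = 0\<close> the hypothesis is the conclusion.\<close>

lemma halving_iterate:
  assumes "0 < \<tau>" "\<tau> \<le> T0" and "0 \<le> s" "s + \<tau> \<le> T"
    and "emeasure lborel {v\<in>{s + \<tau> / 2 ^ n / 2..s + \<tau> / 2 ^ n}. \<alpha> < a (s, v)} \<le> ennreal (\<tau> / 2 ^ n / 8)"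
  shows "emeasure lborel {u\<in>{s + \<tau> / 2..s + \<tau>}. \<alpha> + (1 + c) * (\<Sum>j<n. \<Phi> (\<tau> / 2 ^ j)) < a (s, u)}
    \<le> ennreal (\<tau> / 8)"
  using assms
proof (induction n arbitrary: \<tau>)
  case (Suc n)
  have "emeasure lborel {u\<in>{s + \<tau> / 2 / 2..s + \<tau> / 2}.
      \<alpha> + (1 + c) * (\<Sum>j<n. \<Phi> (\<tau> / 2 / 2 ^ j)) < a (s, u)} \<le> ennreal (\<tau> / 2 / 8)"
    using Suc.prems by (intro Suc.IH) auto
  then have "emeasure lborel {u\<in>{s + \<tau> / 2..s + \<tau>}.
      \<alpha> + (1 + c) * (\<Sum>j<n. \<Phi> (\<tau> / 2 / 2 ^ j)) + (1 + c) * \<Phi> \<tau> < a (s, u)} \<le> ennreal (\<tau> / 8)"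
    using Suc.prems by (intro halving_step) auto
  moreover have "(\<Sum>j<Suc n. \<Phi> (\<tau> / 2 ^ j)) = \<Phi> \<tau> + (\<Sum>j<n. \<Phi> (\<tau> / 2 / 2 ^ j))"
    by (subst sum.lessThan_Suc_shift) simp
  ultimately show ?case
    by (simp add: algebra_simps)
qed simp

text \<open>Regularity provides a scale \<sigma> < \<tau> of the form \<open>T0 / 2 ^ m\<close> at
  which most links from \<open>s\<close> are good. The chain starts there and is doubled up to
  \<tau>. The start costs \<open>c * \<Phi> \<tau>\<close> and the links cost
  \<open>(1 + c) * c * \<Phi> \<tau>\<close>, whence \<open>2 * c + c\<^sup>2\<close>.\<close>

lemma emeasure_regular_point:
  assumes s: "regular s" "0 \<le> s" "s + \<tau> \<le> T" and \<tau>: "0 < \<tau>" "\<tau> \<le> T0"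
  shows "emeasure lborel {u\<in>{s + \<tau> / 2..s + \<tau>}. (2 * c + c\<^sup>2) * \<Phi> \<tau> < a (s, u)} \<le> ennreal (\<tau> / 8)"
proof -
  have "\<forall>\<^sub>F m in sequentially. (1 / 2) ^ m < \<tau> / T0"
    using T0 \<tau> by (intro order_tendstoD(2)[OF LIMSEQ_power_zero]) auto
  then have "\<forall>\<^sub>F m in sequentially. T0 / 2 ^ m < \<tau>"
    by eventually_elim (use T0 in \<open>simp add: field_simps\<close>)
  then obtain m where m: "T0 / 2 ^ m < \<tau>"
      "emeasure lborel {v. (s, v) \<in> bad (T0 / 2 ^ m)} < ennreal (T0 / 2 ^ m / 32)"
    using eventually_happens'[OF _ eventually_conj[OF _ s(1)[unfolded regular_def]]] by fastforce
  define \<sigma> where "\<sigma> = T0 / 2 ^ m"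
  have \<sigma>: "0 < \<sigma>" "\<sigma> < \<tau>"
    using T0 m by (auto simp: \<sigma>_def)
  obtain k where k: "\<sigma> \<le> \<tau> / 2 ^ k" "\<tau> / 2 ^ k \<le> 2 * \<sigma>"
    using dyadic_bracket[of \<sigma> \<tau>] \<sigma> by auto
  \<comment> \<open>The scale \<sigma> need not be a dyadic fraction of \<tau>. One halving beyond
    \<open>k\<close> brings \<open>\<tau> / 2 ^ n\<close> into [\<sigma>/2, \<sigma>]: links of that
    length fall under \<open>bad \<sigma>\<close>, and \<sigma>/32 is still at most an eighth of
    \<open>\<tau> / 2 ^ n\<close>.\<close>
  define n where "n = Suc k"
  have n: "\<tau> / 2 ^ n \<le> \<sigma>" and n': "\<sigma> \<le> 2 * (\<tau> / 2 ^ n)"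
    using k by (auto simp: n_def)
  have "emeasure lborel {v\<in>{s + \<tau> / 2 ^ n / 2..s + \<tau> / 2 ^ n}. \<Phi> \<sigma> < a (s, v)}
      \<le> emeasure lborel {v. (s, v) \<in> bad \<sigma>}"
    using n by (intro emeasure_mono) (auto simp: bad_def)
  also have "\<dots> \<le> ennreal (\<sigma> / 32)"
    using m(2) by (simp add: \<sigma>_def)
  also have "\<dots> \<le> ennreal (\<tau> / 2 ^ n / 8)"
    using n' \<sigma> by (intro ennreal_leI) auto
  finally have "emeasure lborel {u\<in>{s + \<tau> / 2..s + \<tau>}.
      \<Phi> \<sigma> + (1 + c) * (\<Sum>j<n. \<Phi> (\<tau> / 2 ^ j)) < a (s, u)} \<le> ennreal (\<tau> / 8)"
    using assms by (intro halving_iterate) auto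
  moreover have "\<Phi> \<sigma> + (1 + c) * (\<Sum>j<n. \<Phi> (\<tau> / 2 ^ j)) \<le> c * \<Phi> \<tau> + (1 + c) * (c * \<Phi> \<tau>)"
    using \<sigma> \<tau> c_pos by (intro add_mono mult_left_mono dyadic_sum almost_mono) auto
  then have "emeasure lborel {u\<in>{s + \<tau> / 2..s + \<tau>}. (2 * c + c\<^sup>2) * \<Phi> \<tau> < a (s, u)}
      \<le> emeasure lborel {u\<in>{s + \<tau> / 2..s + \<tau>}.
          \<Phi> \<sigma> + (1 + c) * (\<Sum>j<n. \<Phi> (\<tau> / 2 ^ j)) < a (s, u)}"
    by (intro emeasure_mono) (auto simp: algebra_simps power2_eq_square)
  ultimately show ?thesis
    by (rule order_trans[rotated])
qed

text \<open>The reflection preserves the simplex and the length \<open>t - s\<close> and exchanges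
  the two endpoints. Estimates for chains leaving \<open>s\<close> to the right thus become
  estimates for chains leaving \<open>t\<close> to the left.\<close>

lemma reflected: "almost_subadditive (\<lambda>(s, t). a (T - t, T - s)) \<Phi> T T0 c"
proof
  show "(\<lambda>(s, t). a (T - t, T - s)) \<in> borel_measurable borel"
  proof -
    have [measurable]: "fst \<in> borel_measurable (borel :: (real \<times> real) measure)"
        "snd \<in> borel_measurable (borel :: (real \<times> real) measure)"
      by (intro borel_measurable_continuous_onI continuous_intros)+
    show ?thesis
      unfolding case_prod_beta by measurable
  qed
  show "(case (s, t) of (s, t) \<Rightarrow> a (T - t, T - s)) = 0" if "(s, t) \<notin> Delta2 T" for s t
    using that by (auto simp: Delta2_def intro!: off)
  show "emeasure lborel {r. \<Phi> \<tau> < (case (r, r + h) of (s, t) \<Rightarrow> a (T - t, T - s))} \<le> ennreal (\<tau> / 128)"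
    if "0 < \<tau>" "\<tau> \<le> T0" "h \<le> \<tau>" for \<tau> h
    using weak[OF that] emeasure_lborel_reflect[of "{r. \<Phi> \<tau> < a (r, r + h)}" "T - h"]
    by (simp add: algebra_simps)
  show "(case (s, t) of (s, t) \<Rightarrow> a (T - t, T - s)) \<le>
      (case (s, u) of (s, t) \<Rightarrow> a (T - t, T - s)) + (case (u, t) of (s, t) \<Rightarrow> a (T - t, T - s)) + \<Phi> (t - s)"
    if "0 \<le> s" "s \<le> u" "u \<le> t" "t \<le> T" "s < t" for s u t
    using subadd[of "T - t" "T - u" "T - s"] that by (simp add: algebra_simps)
qed (use T0 nonneg almost_mono dyadic_sum c_pos in auto)

text \<open>\<open>G\<close> consists of the points that are regular for \<open>a\<close> and whose
  reflections are regular for the reflected function. Chains from \<open>s\<close> at scale \<tau>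
  and from \<open>t\<close> at scale \<tau>/2 both reach most of a common interval, hence a common
  point \<open>u\<close>.\<close>

lemma AE_pair_bound_short:
  "\<exists>G. (AE s in lborel. s \<in> G) \<and>
     (\<forall>s\<in>G. \<forall>t\<in>G. 0 \<le> s \<longrightarrow> s < t \<longrightarrow> t \<le> T \<longrightarrow> t - s \<le> T0 \<longrightarrow>
        a (s, t) \<le> (2 * c + c\<^sup>2 + (2 * c + c\<^sup>2) * c + 1) * \<Phi> (t - s))"
proof -
  define b where "b = (\<lambda>(s, t). a (T - t, T - s))"
  interpret R: almost_subadditive b \<Phi> T T0 c
    unfolding b_def by (rule reflected)
  define G where "G = {s. regular s \<and> R.regular (T - s)}"
  have "AE s in lborel. s \<in> G"
    using AE_regular AE_lborel_reflect[OF R.AE_regular, of T] by (auto simp: G_def)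
  moreover have "a (s, t) \<le> (2 * c + c\<^sup>2 + (2 * c + c\<^sup>2) * c + 1) * \<Phi> (t - s)"
    if st: "s \<in> G" "t \<in> G" "0 \<le> s" "s < t" "t \<le> T" "t - s \<le> T0" for s t
  proof -
    define \<tau> where "\<tau> = t - s"
    have \<tau>: "0 < \<tau>" "\<tau> \<le> T0" "t = s + \<tau>"
      using st by (auto simp: \<tau>_def)
    define C where "C = 2 * c + c\<^sup>2"
    have C: "0 \<le> C"
      using c_pos by (simp add: C_def)
    define X where "X = {u\<in>{s + \<tau> / 2..s + \<tau>}. C * \<Phi> \<tau> < a (s, u)}"
    define Y where "Y = {u\<in>{t - \<tau> / 2..t - \<tau> / 4}. C * \<Phi> (\<tau> / 2) < a (u, t)}"
    have X: "emeasure lborel X \<le> ennreal (\<tau> / 8)"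
      unfolding X_def C_def using st \<tau> by (intro emeasure_regular_point) (auto simp: G_def)
    define Y' where "Y' = {u\<in>{T - t + \<tau> / 2 / 2..T - t + \<tau> / 2}. C * \<Phi> (\<tau> / 2) < b (T - t, u)}"
    have "emeasure lborel Y' \<le> ennreal (\<tau> / 2 / 8)"
      unfolding Y'_def C_def using st \<tau> by (intro R.emeasure_regular_point) (auto simp: G_def)
    moreover have "Y' \<in> sets borel"
      unfolding Y'_def by measurable
    moreover have "{x. T - x \<in> Y'} = Y"
      by (auto simp: Y_def Y'_def b_def)
    ultimately have Y: "emeasure lborel Y \<le> ennreal (\<tau> / 16)"
      using emeasure_lborel_reflect[of Y' T] by simp
    \<comment> \<open>As \<open>t = s + \<tau>\<close>, this is the whole range of \<open>Y\<close>
      and the left half of that of \<open>X\<close>. Its length \<tau>/4 exceeds the total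
      exceptional measure \<tau>/8 + \<tau>/16.\<close>
    let ?I = "{s + \<tau> / 2..s + 3 * \<tau> / 4}"
    have XY [measurable]: "X \<in> sets borel" "Y \<in> sets borel"
      unfolding X_def Y_def by measurable
    have "\<not> ?I \<subseteq> X \<union> Y"
    proof
      assume "?I \<subseteq> X \<union> Y"
      then have "emeasure lborel ?I \<le> emeasure lborel (X \<union> Y)"
        by (intro emeasure_mono) measurable
      also have "\<dots> \<le> emeasure lborel X + emeasure lborel Y"
        by (intro emeasure_subadditive) measurable
      also have "\<dots> \<le> ennreal (\<tau> / 8) + ennreal (\<tau> / 16)"
        using X Y by (rule add_mono)
      also have "\<dots> = ennreal (3 * \<tau> / 16)"
        using \<tau> by (simp add: ennreal_plus[symmetric] del: ennreal_plus)
      finally show False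
        using \<tau> by simp
    qed
    then obtain u where u: "u \<in> ?I" "u \<notin> X" "u \<notin> Y"
      by blast
    have "a (s, u) \<le> C * \<Phi> \<tau>"
      using u \<tau> by (auto simp: X_def)
    moreover have "a (u, t) \<le> C * \<Phi> (\<tau> / 2)"
      using u \<tau> by (auto simp: Y_def)
    moreover have "C * \<Phi> (\<tau> / 2) \<le> C * (c * \<Phi> \<tau>)"
      using \<tau> C by (intro mult_left_mono almost_mono) auto
    moreover have "a (s, t) \<le> a (s, u) + a (u, t) + \<Phi> (t - s)"
      using u \<tau> st by (intro subadd) auto
    ultimately have "a (s, t) \<le> (C + C * c + 1) * \<Phi> \<tau>"
      by (simp add: \<tau>_def[symmetric] algebra_simps)
    then show ?thesis
      by (simp only: C_def \<tau>_def)
  qed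
  ultimately show ?thesis
    by blast
qed

text \<open>A long interval is cut at two points of \<open>G\<close>, chosen so that each of the
  three pieces is shorter than half of it and so falls under the bound for lengths up to
  \<open>T0\<close>. Cutting at the midpoint would not do, as it may lie outside
  \<open>G\<close>.\<close>

lemma AE_pair_bound:
  assumes "T0 = T / 2"
  shows "\<exists>G. (AE s in lborel. s \<in> G) \<and>
     (\<forall>s\<in>G. \<forall>t\<in>G. 0 \<le> s \<longrightarrow> s < t \<longrightarrow> t \<le> T \<longrightarrow>
        a (s, t) \<le> (1 + 4 * c) * (2 * c + c\<^sup>2 + (2 * c + c\<^sup>2) * c + 1) * \<Phi> (t - s))"
proof -
  define C where "C = 2 * c + c\<^sup>2 + (2 * c + c\<^sup>2) * c + 1"
  have C: "1 \<le> C"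
    using c_pos by (simp add: C_def)
  obtain G where G: "AE s in lborel. s \<in> G"
    and bound: "\<And>s t. s \<in> G \<Longrightarrow> t \<in> G \<Longrightarrow> 0 \<le> s \<Longrightarrow> s < t \<Longrightarrow> t \<le> T \<Longrightarrow> t - s \<le> T0 \<Longrightarrow>
      a (s, t) \<le> C * \<Phi> (t - s)"
    using AE_pair_bound_short unfolding C_def by blast
  have "a (s, t) \<le> (1 + 4 * c) * C * \<Phi> (t - s)"
    if st: "s \<in> G" "t \<in> G" "0 \<le> s" "s < t" "t \<le> T" for s t
  proof -
    define l where "l = t - s"
    have l: "0 < l" "l \<le> T" "t = s + l"
      using st by (auto simp: l_def)
    obtain u where u: "s + l / 4 < u" "u < s + l / 2" "u \<in> G"
      using AE_lborel_dense[OF G, of "s + l / 4" "s + l / 2"] l by auto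
    obtain v where v: "s + l / 2 < v" "v < s + 3 * l / 4" "v \<in> G"
      using AE_lborel_dense[OF G, of "s + l / 2" "s + 3 * l / 4"] l by auto
    have mono: "C * \<Phi> (y - x) \<le> C * (c * \<Phi> l)" if "x < y" "y - x \<le> l" for x y
      using that C by (intro mult_left_mono almost_mono) auto
    have "a (s, u) \<le> C * (c * \<Phi> l)"
      by (intro order_trans[OF bound mono] st u v) (use u l st assms in linarith)+
    moreover have "a (u, v) \<le> C * (c * \<Phi> l)"
      by (intro order_trans[OF bound mono] st u v) (use u v l st assms in linarith)+
    moreover have "a (v, t) \<le> C * (c * \<Phi> l)"
      by (intro order_trans[OF bound mono] st u v) (use v l st assms in linarith)+
    moreover have "a (s, t) \<le> a (s, u) + a (u, t) + \<Phi> l"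
      unfolding l_def by (intro subadd) (use u l st in linarith)+
    moreover have "a (u, t) \<le> a (u, v) + a (v, t) + \<Phi> (t - u)"
      by (intro subadd) (use u v l st in linarith)+
    moreover have "1 * \<Phi> (t - u) \<le> C * \<Phi> (t - u)"
      using C nonneg[of "t - u"] u l by (intro mult_right_mono) auto
    moreover have "1 * \<Phi> l \<le> C * \<Phi> l"
      using C nonneg[of l] l by (intro mult_right_mono) auto
    moreover have "C * \<Phi> (t - u) \<le> C * (c * \<Phi> l)"
      by (intro mono) (use u l in linarith)+
    \<comment> \<open>The three pieces and the defect of the cut at \<open>v\<close> account for the
      four terms with factor \<open>c\<close>; the defect of the cut at \<open>u\<close> is the
      remaining one.\<close>
    moreover have "(1 + 4 * c) * C * \<Phi> (t - s) = C * \<Phi> l + 4 * (C * (c * \<Phi> l))"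
      by (simp add: l_def algebra_simps)
    ultimately show ?thesis
      by linarith
  qed
  then show ?thesis
    using G unfolding C_def by blast
qed

end

subsection \<open>The weight under the integral condition\<close>

text \<open>The denominator of the final estimate. The exponents \<open>min 1 p\<close> and
  \<open>max 1 (1 / p)\<close> are reciprocal, so at positive arguments it is also the power of
  \<open>zeta\<close> that bounds the defect of additivity.\<close>

definition weight :: "ennreal \<Rightarrow> (real \<Rightarrow> real) \<Rightarrow> real \<Rightarrow> real" where
  "weight p \<omega> \<tau> = \<omega> \<tau> * \<tau> powr (- enn2real (1 / p))"

lemma exponent_props:
  fixes p :: ennreal
  assumes "0 < p"
  shows "0 < enn2real (min 1 p)" and "1 \<le> enn2real (max 1 (1 / p))"
    and "enn2real (min 1 p) * enn2real (max 1 (1 / p)) = 1"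
proof -
  have "0 < enn2real (min 1 p) \<and> 1 \<le> enn2real (max 1 (1 / p))
      \<and> enn2real (min 1 p) * enn2real (max 1 (1 / p)) = 1"
  proof (cases p)
    case (real r)
    then have r: "0 < r"
      using assms by (simp add: ennreal_less_iff)
    then have "1 / p = ennreal (1 / r)"
      using real by (simp add: divide_ennreal ennreal_1[symmetric] del: ennreal_1)
    moreover have "min 1 p = ennreal (min 1 r)"
      using r real by (auto simp: min_def ennreal_1[symmetric] simp del: ennreal_1)
    moreover have "max 1 (ennreal (1 / r)) = ennreal (max 1 (1 / r))"
      using r by (auto simp: max_def ennreal_1[symmetric] simp del: ennreal_1)
    ultimately show ?thesis
      using r by (auto simp: min_def max_def divide_simps)
  next
    case top
    then show ?thesis
      by simp
  qed
  then show "0 < enn2real (min 1 p)" "1 \<le> enn2real (max 1 (1 / p))"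
    "enn2real (min 1 p) * enn2real (max 1 (1 / p)) = 1"
    by auto
qed

lemma zeta_nonneg: "0 \<le> zeta p \<omega> \<tau>"
  by (simp add: zeta_def)

lemma zeta_powr_eq_weight:
  assumes "0 < p" and "0 < \<tau>" and "0 \<le> \<omega> \<tau>"
  shows "zeta p \<omega> \<tau> powr enn2real (max 1 (1 / p)) = weight p \<omega> \<tau>"
  using assms exponent_props(3)[OF assms(1)]
  by (simp add: zeta_def weight_def powr_powr powr_minus divide_inverse)

text \<open>The embedding of l^1 into l^e: each term is at most the total \<open>X\<close>, so
  \<open>X powr (e - 1)\<close> can be pulled out of the sum.\<close>

lemma sum_powr_le_powr_sum:
  fixes f :: "'a \<Rightarrow> real"
  assumes "finite A" and nonneg: "\<And>x. x \<in> A \<Longrightarrow> 0 \<le> f x" and e: "1 \<le> e"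
  shows "(\<Sum>x\<in>A. f x powr e) \<le> (\<Sum>x\<in>A. f x) powr e"
proof -
  define X where "X = (\<Sum>x\<in>A. f x)"
  have split: "y powr e = y * y powr (e - 1)" if "0 \<le> y" for y
    using that by (cases "y = 0") (auto simp: powr_diff)
  have "(\<Sum>x\<in>A. f x powr e) = (\<Sum>x\<in>A. f x * f x powr (e - 1))"
    using nonneg by (intro sum.cong split) auto
  also have "\<dots> \<le> (\<Sum>x\<in>A. f x * X powr (e - 1))"
    using assms unfolding X_def
    by (intro sum_mono mult_left_mono powr_mono2 member_le_sum) auto
  also have "\<dots> = X powr e"
    using nonneg by (simp add: split X_def sum_nonneg sum_distrib_right[symmetric])
  finally show ?thesis
    unfolding X_def .
qed

text \<open>Here \<open>k\<close> is the loss when \<open>zeta\<close> is compared at points within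
  a factor two, and \<open>1 + 2 * K * k\<close> bounds the dyadic sums. The outer \<open>k\<close>
  makes the same constant work for almost monotonicity.\<close>

definition dini_const :: "ennreal \<Rightarrow> real \<Rightarrow> real" where
  "dini_const p K = (let k = 2 powr (enn2real (1 / p) * enn2real (min 1 p)) in k * (1 + 2 * K * k))"

context
  fixes p :: ennreal and K :: real and \<omega> :: "real \<Rightarrow> real"
  assumes p: "0 < p" and K: "0 < K"
    and \<omega>_nonneg: "\<forall>r\<ge>0. 0 \<le> \<omega> r" and \<omega>_mono: "mono_on {0..} \<omega>"
    and dini: "\<forall>S>0. (\<integral>\<^sup>+h\<in>{0<..S}. ennreal (zeta p \<omega> h / h) \<partial>lborel) \<le> ennreal (K * zeta p \<omega> S)"
begin

text \<open>The numerator is controlled by monotonicity of \<omega>, and the denominator grows by at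
  most \<open>2 powr enn2real (1 / p)\<close> over a factor two.\<close>

lemma zeta_doubling:
  assumes "0 < x" "x \<le> y" "y \<le> 2 * x"
  shows "zeta p \<omega> x \<le> 2 powr (enn2real (1 / p) * enn2real (min 1 p)) * zeta p \<omega> y"
proof -
  define b where "b = enn2real (1 / p)"
  have "\<omega> x \<le> \<omega> y"
    using assms by (intro mono_onD[OF \<omega>_mono]) auto
  have "\<omega> x / x powr b \<le> \<omega> y / x powr b"
    using \<open>\<omega> x \<le> \<omega> y\<close> by (intro divide_right_mono) auto
  also have "\<dots> \<le> \<omega> y / (y / 2) powr b"
    using assms \<omega>_nonneg by (intro divide_left_mono powr_mono2) (auto simp: b_def)
  also have "\<dots> = 2 powr b * (\<omega> y / y powr b)"
    using assms by (simp add: powr_divide)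
  finally have "(\<omega> x / x powr b) powr enn2real (min 1 p)
      \<le> (2 powr b * (\<omega> y / y powr b)) powr enn2real (min 1 p)"
    using assms \<omega>_nonneg by (intro powr_mono2) auto
  also have "\<dots> = 2 powr (b * enn2real (min 1 p)) * (\<omega> y / y powr b) powr enn2real (min 1 p)"
    using assms \<omega>_nonneg by (subst powr_mult) (auto simp: powr_powr)
  finally show ?thesis
    unfolding zeta_def b_def[symmetric] .
qed

text \<open>The integral condition is tested on the disjoint intervals (S/2^(n+1), S/2^n]. Each
  contributes at least \<open>zeta p \<omega> (S / 2 ^ Suc n) / (2 * k)\<close>, by
  \<open>zeta_doubling\<close> and because \<open>h\<close> is at most twice the left
  endpoint.\<close>

lemma sum_zeta_halves_le:
  assumes S: "0 < S"
  shows "(\<Sum>n<N. zeta p \<omega> (S / 2 ^ Suc n))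
    \<le> 2 * K * 2 powr (enn2real (1 / p) * enn2real (min 1 p)) * zeta p \<omega> S"
proof -
  define k where "k = 2 powr (enn2real (1 / p) * enn2real (min 1 p))"
  have k: "0 < k"
    by (simp add: k_def)
  define I where "I n = {S / 2 ^ Suc n<..S / 2 ^ n}" for n
  \<comment> \<open>The constant lower bound for the integrand on \<open>I n\<close>, an interval of
    length \<open>S / 2 ^ Suc n\<close>.\<close>
  define z where "z n = zeta p \<omega> (S / 2 ^ Suc n) / (k * (2 * (S / 2 ^ Suc n)))" for n
  have z: "0 \<le> z n" for n
    using S k by (simp add: z_def zeta_nonneg)
  have disj: "(\<Sum>n<N. indicator (I n) h :: ennreal) = indicator {S / 2 ^ N<..S} h" for h
  proof (induction N)
    case (Suc N)
    have "S / 2 ^ Suc N \<le> S / 2 ^ N" "S / 2 ^ N \<le> S"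
      using S by (auto simp: field_simps)
    with Suc show ?case
      by (auto simp: I_def indicator_def)
  qed simp
  have "ennreal (z n) * indicator (I n) h \<le> ennreal (zeta p \<omega> h / h) * indicator (I n) h" for n h
  proof (cases "h \<in> I n")
    case True
    then have h: "S / 2 ^ Suc n < h" "h \<le> 2 * (S / 2 ^ Suc n)"
      by (auto simp: I_def)
    have pos: "0 < S / 2 ^ Suc n"
      using S by simp
    have "zeta p \<omega> (S / 2 ^ Suc n) \<le> k * zeta p \<omega> h"
      unfolding k_def using S h by (intro zeta_doubling) auto
    then have "zeta p \<omega> (S / 2 ^ Suc n) / k \<le> zeta p \<omega> h"
      using k by (simp add: field_simps)
    then have "zeta p \<omega> (S / 2 ^ Suc n) / k / (2 * (S / 2 ^ Suc n)) \<le> zeta p \<omega> h / h"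
      using pos h by (intro frac_le zeta_nonneg) auto
    then show ?thesis
      using True by (auto simp: z_def intro!: ennreal_leI)
  qed simp
  then have "(\<Sum>n<N. ennreal (z n) * indicator (I n) h) \<le> (\<Sum>n<N. ennreal (zeta p \<omega> h / h) * indicator (I n) h)" for h
    by (intro sum_mono)
  moreover have "(\<Sum>n<N. ennreal (zeta p \<omega> h / h) * indicator (I n) h)
      \<le> ennreal (zeta p \<omega> h / h) * indicator {0<..S} h" for h
    unfolding sum_distrib_left[symmetric] disj using S
    by (intro mult_left_mono) (auto simp: indicator_def intro: order.strict_trans1[rotated])
  ultimately have "(\<integral>\<^sup>+h. (\<Sum>n<N. ennreal (z n) * indicator (I n) h) \<partial>lborel)
      \<le> (\<integral>\<^sup>+h\<in>{0<..S}. ennreal (zeta p \<omega> h / h) \<partial>lborel)"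
    by (intro nn_integral_mono) (rule order_trans)
  also have "\<dots> \<le> ennreal (K * zeta p \<omega> S)"
    using dini S by simp
  also have "(\<integral>\<^sup>+h. (\<Sum>n<N. ennreal (z n) * indicator (I n) h) \<partial>lborel)
      = (\<Sum>n<N. ennreal (zeta p \<omega> (S / 2 ^ Suc n) / (2 * k)))"
  proof -
    have "(\<integral>\<^sup>+h. (\<Sum>n<N. ennreal (z n) * indicator (I n) h) \<partial>lborel)
        = (\<Sum>n<N. ennreal (z n) * emeasure lborel (I n))"
      by (subst nn_integral_sum) (auto simp: I_def nn_integral_cmult_indicator)
    also have "\<dots> = (\<Sum>n<N. ennreal (zeta p \<omega> (S / 2 ^ Suc n) / (2 * k)))"
    proof (intro sum.cong refl)
      fix n
      have "emeasure lborel (I n) = ennreal (S / 2 ^ Suc n)"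
        using S by (simp add: I_def field_simps)
      then show "ennreal (z n) * emeasure lborel (I n) = ennreal (zeta p \<omega> (S / 2 ^ Suc n) / (2 * k))"
        using S z[of n] by (simp add: ennreal_mult[symmetric]) (simp add: z_def mult.commute)
    qed
    finally show ?thesis .
  qed
  finally have "(\<Sum>n<N. zeta p \<omega> (S / 2 ^ Suc n) / (2 * k)) \<le> K * zeta p \<omega> S"
    using k K by (simp add: zeta_nonneg sum_nonneg)
  then show ?thesis
    using k unfolding k_def[symmetric] by (simp add: sum_divide_distrib[symmetric] field_simps)
qed

text \<open>This adds the term \<open>n = 0\<close>. It is kept apart from the bound by
  \<open>dini_const\<close> because \<open>zeta_almost_mono\<close> multiplies it by
  \<open>k\<close> once more.\<close>

lemma sum_zeta_le_sharp:
  assumes S: "0 < S"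
  shows "(\<Sum>n<N. zeta p \<omega> (S / 2 ^ n))
    \<le> (1 + 2 * K * 2 powr (enn2real (1 / p) * enn2real (min 1 p))) * zeta p \<omega> S"
proof -
  have "(\<Sum>n<N. zeta p \<omega> (S / 2 ^ n)) \<le> (\<Sum>n<Suc N. zeta p \<omega> (S / 2 ^ n))"
    by (simp add: zeta_nonneg)
  also have "\<dots> = zeta p \<omega> S + (\<Sum>n<N. zeta p \<omega> (S / 2 ^ Suc n))"
    by (subst sum.lessThan_Suc_shift) simp
  finally show ?thesis
    using sum_zeta_halves_le[OF S, of N] by (simp add: algebra_simps)
qed

lemma dini_const_ge: "1 + 2 * K * 2 powr (enn2real (1 / p) * enn2real (min 1 p)) \<le> dini_const p K"
proof -
  define k where "k = 2 powr (enn2real (1 / p) * enn2real (min 1 p))"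
  have "1 \<le> k"
    unfolding k_def by (intro ge_one_powr_ge_zero) auto
  then have "1 * (1 + 2 * K * k) \<le> k * (1 + 2 * K * k)"
    using K by (intro mult_right_mono) auto
  then show ?thesis
    by (simp add: dini_const_def k_def Let_def)
qed

lemma dini_const_pos: "0 < dini_const p K"
  using K by (simp add: dini_const_def Let_def add_pos_pos)

lemma sum_zeta_le:
  assumes S: "0 < S"
  shows "(\<Sum>n<N. zeta p \<omega> (S / 2 ^ n)) \<le> dini_const p K * zeta p \<omega> S"
  using sum_zeta_le_sharp[OF S, of N] mult_right_mono[OF dini_const_ge zeta_nonneg, of p \<omega> S] by linarith

text \<open>Up to the factor \<open>k\<close>, the value at \<open>x\<close> is bounded by that at a
  dyadic fraction of \<open>y\<close> within a factor two of \<open>x\<close>, which is a single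
  term of the dyadic sum controlled by \<open>zeta p \<omega> y\<close>.\<close>

lemma zeta_almost_mono:
  assumes "0 < x" "x \<le> y"
  shows "zeta p \<omega> x \<le> dini_const p K * zeta p \<omega> y"
proof -
  define k where "k = 2 powr (enn2real (1 / p) * enn2real (min 1 p))"
  have k: "0 < k"
    by (simp add: k_def)
  obtain n where n: "x \<le> y / 2 ^ n" "y / 2 ^ n \<le> 2 * x"
    using dyadic_bracket[OF assms] .
  have "zeta p \<omega> x \<le> k * zeta p \<omega> (y / 2 ^ n)"
    unfolding k_def using assms n by (intro zeta_doubling)
  also have "zeta p \<omega> (y / 2 ^ n) \<le> (\<Sum>j<Suc n. zeta p \<omega> (y / 2 ^ j))"
    by (intro member_le_sum zeta_nonneg) auto
  also have "\<dots> \<le> (1 + 2 * K * k) * zeta p \<omega> y"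
    unfolding k_def using assms by (intro sum_zeta_le_sharp) auto
  finally show ?thesis
    using k by (simp add: dini_const_def k_def Let_def mult.assoc)
qed

lemma weight_nonneg: "0 < \<tau> \<Longrightarrow> 0 \<le> weight p \<omega> \<tau>"
  using \<omega>_nonneg by (simp add: weight_def)

lemma zeta_powr: "0 < \<tau> \<Longrightarrow> zeta p \<omega> \<tau> powr enn2real (max 1 (1 / p)) = weight p \<omega> \<tau>"
  using p \<omega>_nonneg by (intro zeta_powr_eq_weight) auto

lemma weight_almost_mono:
  assumes "0 < x" "x \<le> y"
  shows "weight p \<omega> x \<le> dini_const p K powr enn2real (max 1 (1 / p)) * weight p \<omega> y"
proof -
  have "zeta p \<omega> x powr enn2real (max 1 (1 / p))
      \<le> (dini_const p K * zeta p \<omega> y) powr enn2real (max 1 (1 / p))"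
    using zeta_almost_mono[OF assms] by (intro powr_mono2 zeta_nonneg) auto
  then show ?thesis
    using assms dini_const_pos by (simp add: powr_mult zeta_nonneg zeta_powr)
qed

lemma sum_weight_le:
  assumes S: "0 < S"
  shows "(\<Sum>n<N. weight p \<omega> (S / 2 ^ n)) \<le> dini_const p K powr enn2real (max 1 (1 / p)) * weight p \<omega> S"
proof -
  have "(\<Sum>n<N. weight p \<omega> (S / 2 ^ n)) = (\<Sum>n<N. zeta p \<omega> (S / 2 ^ n) powr enn2real (max 1 (1 / p)))"
    using S by (simp add: zeta_powr)
  also have "\<dots> \<le> (\<Sum>n<N. zeta p \<omega> (S / 2 ^ n)) powr enn2real (max 1 (1 / p))"
    using exponent_props[OF p] by (intro sum_powr_le_powr_sum zeta_nonneg) auto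
  also have "\<dots> \<le> (dini_const p K * zeta p \<omega> S) powr enn2real (max 1 (1 / p))"
    using sum_zeta_le[OF S] by (intro powr_mono2 sum_nonneg zeta_nonneg) auto
  also have "\<dots> = dini_const p K powr enn2real (max 1 (1 / p)) * weight p \<omega> S"
    using S dini_const_pos by (simp add: powr_mult zeta_nonneg zeta_powr)
  finally show ?thesis .
qed

end

subsection \<open>From the Besov norm to weak-type bounds\<close>

text \<open>Chebyshev's inequality at the level whose \<open>p\<close>-th power is
  R^p/(\<epsilon>\<tau>). For \<open>p = \<infinity>\<close> both powers with exponent
  \<open>1 / p\<close> equal 1, the level is \<open>R\<close>, and the set is null.\<close>

lemma Lp_qnorm_weak_type:
  assumes p: "0 < p" and [measurable]: "f \<in> borel_measurable N" and nonneg: "\<And>x. 0 \<le> f x"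
    and R: "0 \<le> R" "Lp_qnorm p N (\<lambda>x. ennreal (f x)) \<le> ennreal R" and "0 < \<tau>" "0 < \<epsilon>"
  shows "emeasure N {x \<in> space N. (1 / \<epsilon>) powr enn2real (1 / p) * R * \<tau> powr (- enn2real (1 / p)) < f x}
    \<le> ennreal (\<epsilon> * \<tau>)"
proof (cases p)
  case (real r)
  then have r: "0 < r"
    using p by (simp add: ennreal_less_iff)
  then have inv: "1 / p = ennreal (1 / r)"
    using real by (simp add: divide_ennreal ennreal_1[symmetric] del: ennreal_1)
  define J where "J = (\<integral>\<^sup>+x. ennreal (f x powr r) \<partial>N)"
  have "Lp_qnorm p N (\<lambda>x. ennreal (f x)) = epowr J (1 / r)"
    using real r nonneg by (simp add: Lp_qnorm_def epowr_def J_def)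
  then have "epowr J (1 / r) \<le> ennreal R"
    using R by simp
  then have J: "J \<le> ennreal (R powr r)"
  proof (cases J)
    case (real j)
    then have "j powr (1 / r) \<le> R"
      using R \<open>epowr J (1 / r) \<le> ennreal R\<close> by (simp add: epowr_def)
    then have "(j powr (1 / r)) powr r \<le> R powr r"
      using r by (intro powr_mono2) auto
    then show ?thesis
      using real r by (simp add: powr_powr)
  qed (simp add: epowr_def top_unique)
  show ?thesis
  \<comment> \<open>At level zero Markov's inequality cannot be normalised; instead the vanishing
    integral gives \<open>f = 0\<close> almost everywhere.\<close>
  proof (cases "R = 0")
    case True
    then have "J = 0"
      using J by simp
    then have "AE x in N. f x powr r = 0"
      unfolding J_def by (subst (asm) nn_integral_0_iff_AE) auto
    then have "AE x in N. \<not> 0 < f x"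
      by eventually_elim auto
    then have "emeasure N {x \<in> space N. 0 < f x} = 0"
      by (subst (asm) AE_iff_measurable[OF _ refl]) auto
    then show ?thesis
      using True by simp
  next
    case False
    then have R: "0 < R"
      using R by simp
    define l where "l = (1 / \<epsilon>) powr (1 / r) * R * \<tau> powr (- (1 / r))"
    have l: "0 < l"
      using R assms(6,7) by (simp add: l_def)
    have lr: "l powr r = R powr r / (\<epsilon> * \<tau>)"
      using R r assms(6,7) by (simp add: l_def powr_mult powr_powr powr_divide powr_minus_divide[of _ 1])
    have "emeasure N {x \<in> space N. l < f x}
        \<le> emeasure N ({x \<in> space N. 1 \<le> ennreal (1 / l powr r) * ennreal (f x powr r)})"
    proof (intro emeasure_mono)
      show "{x \<in> space N. l < f x} \<subseteq> {x \<in> space N. 1 \<le> ennreal (1 / l powr r) * ennreal (f x powr r)}"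
      proof safe
        fix x
        assume "l < f x"
        then have "l powr r \<le> f x powr r"
          using l r by (intro powr_mono2) auto
        then have "1 \<le> 1 / l powr r * f x powr r"
          using l by simp
        then show "1 \<le> ennreal (1 / l powr r) * ennreal (f x powr r)"
          by (simp add: ennreal_mult[symmetric])
      qed
    qed measurable
    also have "\<dots> \<le> ennreal (1 / l powr r) * (\<integral>\<^sup>+x. ennreal (f x powr r) * indicator (space N) x \<partial>N)"
      by (rule order_trans[OF _ nn_integral_Markov_inequality]) auto
    also have "(\<integral>\<^sup>+x. ennreal (f x powr r) * indicator (space N) x \<partial>N) = J"
      unfolding J_def by (intro nn_integral_cong) auto
    also have "ennreal (1 / l powr r) * J \<le> ennreal (1 / l powr r) * ennreal (R powr r)"
      using J by (intro mult_left_mono) auto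
    also have "\<dots> = ennreal (\<epsilon> * \<tau>)"
      using R assms(6,7) unfolding lr by (simp add: ennreal_mult[symmetric])
    finally show ?thesis
      using r by (simp add: l_def inv)
  qed
next
  case top
  have "AE x in N. ennreal (f x) \<le> esssup N (\<lambda>x. ennreal (f x))"
    by (rule esssup_AE)
  then have "AE x in N. \<not> R < f x"
  proof eventually_elim
    case (elim x)
    also have "esssup N (\<lambda>x. ennreal (f x)) \<le> ennreal R"
      using R top by (simp add: Lp_qnorm_def)
    finally show ?case
      using R by simp
  qed
  then have "emeasure N {x \<in> space N. R < f x} = 0"
    by (subst (asm) AE_iff_measurable[OF _ refl]) auto
  then show ?thesis
    using top \<open>0 < \<tau>\<close> \<open>0 < \<epsilon>\<close> by simp
qed

lemma ennreal_divide_antimono: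
  fixes x y z :: ennreal
  assumes "y \<le> z"
  shows "x / z \<le> x / y"
proof -
  have "inverse z \<le> inverse y"
  proof (cases "y = 0 \<or> z = \<infinity>")
    case False
    then obtain a b where "y = ennreal a" "z = ennreal b" "0 < a" "0 \<le> b"
      by (cases y; cases z) (use assms in \<open>auto simp: top_unique less_le\<close>)
    then show ?thesis
      using assms by (auto simp: inverse_ennreal intro!: ennreal_leI le_imp_inverse_le)
  qed auto
  then show ?thesis
    by (simp add: divide_ennreal_def mult_left_mono)
qed

text \<open>On \<open>{\<tau>..2 * \<tau>}\<close> the numerator of the Besov quotient is at least
  its value at \<tau> and \<omega> is at most \<open>D * \<omega> \<tau>\<close>, so the quotient is
  at least \<open>x\<close>. This interval has mass at least 1/2 for d\<tau>/\<tau>, so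
  \<open>x\<close> is at most \<open>2 powr enn2real (1 / q) * b\<close>. The interval has to fit
  into (0, T], whence the later restriction to scales up to \<open>T / 2\<close>.\<close>

lemma Omega_le:
  assumes q: "0 < q" and "0 < D" and \<omega>_mono: "mono_on {0..} \<omega>"
    and doubling: "\<omega> (2 * \<tau>) \<le> D * \<omega> \<tau>" and \<tau>: "0 < \<tau>" "2 * \<tau> \<le> T"
    and fin: "besov_qnorm m T p q \<omega> A = ennreal b" "0 \<le> b" and "0 \<le> \<omega> \<tau>"
  shows "Omega m T p A \<tau> \<le> ennreal (D * 2 powr enn2real (1 / q) * b * \<omega> \<tau>)"
proof -
  define N where "N = density (restrict_space lborel {0<..T}) (\<lambda>\<tau>. ennreal (1 / \<tau>))"
  define F where "F = (\<lambda>\<tau>. Omega m T p A \<tau> / ennreal (\<omega> \<tau>))"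
  define x where "x = Omega m T p A \<tau> / ennreal (D * \<omega> \<tau>)"
  have le: "x \<le> F s" if s: "s \<in> {\<tau>..2 * \<tau>}" for s
  proof -
    have "Omega m T p A \<tau> \<le> Omega m T p A s"
      unfolding Omega_def using s by (intro SUP_subset_mono) auto
    moreover have "\<omega> s \<le> D * \<omega> \<tau>"
      using mono_onD[OF \<omega>_mono, of s "2 * \<tau>"] s \<tau> doubling by auto
    ultimately show ?thesis
      unfolding x_def F_def
      by (intro order_trans[OF divide_right_mono_ennreal ennreal_divide_antimono] ennreal_leI)
  qed
  have sets: "{\<tau>..2 * \<tau>} \<in> sets (restrict_space lborel {0<..T})"
    using \<tau> by (auto simp: sets_restrict_space_iff)
  have "ennreal (1 / 2) \<le> emeasure N {\<tau>..2 * \<tau>}"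
  proof -
    have "ennreal (1 / 2) = ennreal (1 / (2 * \<tau>)) * emeasure lborel {\<tau>..2 * \<tau>}"
      using \<tau> by (simp add: ennreal_mult[symmetric])
    also have "\<dots> = ennreal (1 / (2 * \<tau>)) * emeasure (restrict_space lborel {0<..T}) {\<tau>..2 * \<tau>}"
      using \<tau> by (subst emeasure_restrict_space) auto
    also have "\<dots> = (\<integral>\<^sup>+s. ennreal (1 / (2 * \<tau>)) * indicator {\<tau>..2 * \<tau>} s \<partial>restrict_space lborel {0<..T})"
      using sets by (simp add: nn_integral_cmult_indicator)
    also have "\<dots> \<le> (\<integral>\<^sup>+s. ennreal (1 / s) * indicator {\<tau>..2 * \<tau>} s \<partial>restrict_space lborel {0<..T})"
      using \<tau> by (intro nn_integral_mono) (auto simp: indicator_def field_simps intro!: ennreal_leI)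
    also have "\<dots> = emeasure N {\<tau>..2 * \<tau>}"
      unfolding N_def using sets by (intro emeasure_density[symmetric]) (auto intro: measurable_restrict_space1)
    finally show ?thesis .
  qed
  moreover have setsN: "{\<tau>..2 * \<tau>} \<in> sets N"
    using sets by (simp add: N_def)
  ultimately have x: "x \<le> ennreal (2 powr enn2real (1 / q) * b)"
  proof (cases q)
    case (real r)
    then have r: "0 < r"
      using q by (simp add: ennreal_less_iff)
    then have inv: "1 / q = ennreal (1 / r)"
      using real by (simp add: divide_ennreal ennreal_1[symmetric] del: ennreal_1)
    have mono: "epowr y s \<le> epowr z s" if "y \<le> z" "0 < s" for y z s
      using that by (cases y; cases z) (auto simp: epowr_def top_unique intro!: ennreal_leI powr_mono2)
    have "epowr x r * ennreal (1 / 2) \<le> epowr x r * emeasure N {\<tau>..2 * \<tau>}"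
      using \<open>ennreal (1 / 2) \<le> emeasure N {\<tau>..2 * \<tau>}\<close> by (intro mult_left_mono) auto
    also have "\<dots> = (\<integral>\<^sup>+s. epowr x r * indicator {\<tau>..2 * \<tau>} s \<partial>N)"
      using setsN by (simp add: nn_integral_cmult_indicator)
    also have "\<dots> \<le> (\<integral>\<^sup>+s. epowr (F s) r \<partial>N)"
      using le r by (intro nn_integral_mono) (auto simp: indicator_def intro!: mono)
    finally have "epowr (epowr x r * ennreal (1 / 2)) (1 / r) \<le> ennreal b"
      using fin r real unfolding besov_qnorm_def F_def[symmetric] N_def[symmetric]
      by (simp add: Lp_qnorm_def) (metis mono order_trans zero_less_divide_1_iff)
    then show ?thesis
    proof (cases x)
      case (real y)
      then have "(y powr r * (1 / 2)) powr (1 / r) \<le> b"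
        using \<open>epowr (epowr x r * ennreal (1 / 2)) (1 / r) \<le> ennreal b\<close> fin(2)
        by (simp add: epowr_def ennreal_mult[symmetric] del: ennreal_half)
      moreover have "(y powr r * (1 / 2)) powr (1 / r) = y / 2 powr (1 / r)"
        using real r by (simp add: powr_mult powr_powr powr_divide)
      ultimately have "y / 2 powr (1 / r) \<le> b"
        by simp
      then have "y \<le> 2 powr (1 / r) * b"
        by (simp add: pos_divide_le_eq mult.commute)
      then show ?thesis
        using real r by (simp add: inv ennreal_leI)
    qed (simp add: epowr_def ennreal_top_mult top_unique)
  next
    case top
    have "AE s in N. F s \<le> ennreal b"
      using fin top esssup_AE[of F N] unfolding besov_qnorm_def F_def[symmetric] N_def[symmetric]
      by (simp add: Lp_qnorm_def)
    \<comment> \<open>An interval of positive mass meets the full set on which the essential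
      supremum is a bound.\<close>
    have "\<exists>s\<in>{\<tau>..2 * \<tau>}. F s \<le> ennreal b"
    proof (rule ccontr)
      assume *: "\<not> ?thesis"
      have "AE s in N. s \<notin> {\<tau>..2 * \<tau>}"
        using \<open>AE s in N. F s \<le> ennreal b\<close> by eventually_elim (use * in auto)
      then have "{\<tau>..2 * \<tau>} \<in> null_sets N"
        using setsN by (subst (asm) AE_iff_null_sets[symmetric]) auto
      then show False
        using \<open>ennreal (1 / 2) \<le> emeasure N {\<tau>..2 * \<tau>}\<close> by (auto simp: null_sets_def)
    qed
    then have "x \<le> ennreal b"
      using le order_trans by blast
    then show ?thesis
      using top by simp
  qed
  have "Omega m T p A \<tau> \<le> x * ennreal (D * \<omega> \<tau>)"
  \<comment> \<open>With a zero denominator the finiteness of \<open>x\<close> forces the numerator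
    to vanish.\<close>
  proof (cases "D * \<omega> \<tau> = 0")
    case True
    then have "Omega m T p A \<tau> = 0"
      using x by (auto simp: x_def top_unique split: if_splits)
    then show ?thesis
      by simp
  next
    case False
    then have "0 < D * \<omega> \<tau>"
      using \<open>0 < D\<close> \<open>0 \<le> \<omega> \<tau>\<close> by (auto simp: less_le)
    moreover have "y / ennreal c * ennreal c = y" if "0 < c" for y c
      using that by (simp add: ennreal_divide_times)
    ultimately show ?thesis
      by (simp add: x_def)
  qed
  also have "\<dots> \<le> ennreal (2 powr enn2real (1 / q) * b) * ennreal (D * \<omega> \<tau>)"
    using x by (rule mult_right_mono) simp
  also have "\<dots> = ennreal (D * 2 powr enn2real (1 / q) * b * \<omega> \<tau>)"
    using fin(2) \<open>0 < D\<close> \<open>0 \<le> \<omega> \<tau>\<close> by (subst ennreal_mult[symmetric]) (auto simp: mult_ac)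
  finally show ?thesis .
qed

subsection \<open>Continuous extension\<close>

lemma vec_norm_nonneg: "0 \<le> vec_norm m x"
  by (simp add: vec_norm_def L2_set_nonneg)

lemma abs_le_vec_norm:
  assumes "i < m"
  shows "\<bar>x i\<bar> \<le> vec_norm m x"
proof -
  have "\<bar>x i\<bar> = sqrt ((x i)\<^sup>2)"
    by simp
  also have "\<dots> \<le> sqrt (\<Sum>i<m. (x i)\<^sup>2)"
    using assms by (intro real_sqrt_le_mono member_le_sum) auto
  finally show ?thesis
    by (simp add: vec_norm_def L2_set_def)
qed

lemma vec_norm_delta_triangle:
  "vec_norm m (A (s, t)) \<le> vec_norm m (A (s, u)) + vec_norm m (A (u, t)) + vec_norm m (delta A s u t)"
proof -
  have "vec_norm m (A (s, t)) = L2_set (\<lambda>i. (A (s, u) i + A (u, t) i) + delta A s u t i) {..<m}"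
    by (simp add: vec_norm_def delta_def)
  also have "\<dots> \<le> L2_set (\<lambda>i. A (s, u) i + A (u, t) i) {..<m} + L2_set (delta A s u t) {..<m}"
    by (rule L2_set_triangle_ineq)
  also have "\<dots> \<le> L2_set (A (s, u)) {..<m} + L2_set (A (u, t)) {..<m} + L2_set (delta A s u t) {..<m}"
    by (intro add_right_mono L2_set_triangle_ineq)
  finally show ?thesis
    unfolding vec_norm_def .
qed

lemma closed_Delta2: "closed (Delta2 T)"
proof -
  have "Delta2 T = {z. 0 \<le> fst z} \<inter> {z. fst z \<le> snd z} \<inter> {z. snd z \<le> T}"
    by (auto simp: Delta2_def)
  then show ?thesis
    by (simp add: closed_Int closed_Collect_le continuous_on_fst continuous_on_snd)
qed

lemma AE_lborel_prod:
  assumes "AE x in (lborel :: real measure). P x"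
  shows "AE z in (lborel :: (real \<times> real) measure). P (fst z) \<and> P (snd z)"
proof -
  obtain N where N: "\<And>x. x \<notin> N \<Longrightarrow> P x" "N \<in> null_sets lborel"
    using AE_E3[OF assms] by auto
  have [measurable]: "N \<in> sets borel"
    using N(2) by auto
  have *: "AE x in lborel. x \<notin> N"
    using N(2) by (rule AE_not_in)
  have "AE z in lborel \<Otimes>\<^sub>M lborel. fst z \<notin> N \<and> snd z \<notin> N"
  proof (rule lborel_pair.AE_pair_measure)
    show "AE x in lborel. AE y in lborel. fst (x, y) \<notin> N \<and> snd (x, y) \<notin> N"
      using * by eventually_elim (use * in simp)
  qed measurable
  then have "AE z in (lborel :: (real \<times> real) measure). fst z \<notin> N \<and> snd z \<notin> N"
    by (simp only: lborel_prod)
  then show ?thesis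
    by eventually_elim (auto intro: N)
qed

text \<open>Approximation from inside keeps \<open>t' - s' \<le> t - s\<close>, so that almost
  monotonicity transfers a bound by the weight to the limit; \<omega> itself need not be
  continuous.\<close>

lemma Delta2_inner_approx:
  fixes s t d :: real
  assumes G: "AE s in lborel. s \<in> G" and "s < t" "0 < d"
  obtains s' t' where "s' \<in> G" "t' \<in> G" "s \<le> s'" "s' < t'" "t' \<le> t" "dist (s', t') (s, t) < d"
proof -
  define \<delta> where "\<delta> = min (d / 2) ((t - s) / 2)"
  have \<delta>: "0 < \<delta>" "\<delta> \<le> d / 2" "\<delta> \<le> (t - s) / 2"
    using assms by (auto simp: \<delta>_def min_def)
  obtain s' where s': "s < s'" "s' < s + \<delta>" "s' \<in> G"
    using AE_lborel_dense[OF G, of s "s + \<delta>"] \<delta> by auto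
  obtain t' where t': "t - \<delta> < t'" "t' < t" "t' \<in> G"
    using AE_lborel_dense[OF G, of "t - \<delta>" t] \<delta> by auto
  have "dist (s', t') (s, t) \<le> \<bar>s' - s\<bar> + \<bar>t' - t\<bar>"
    by (simp add: dist_Pair_Pair dist_real_def sqrt_sum_squares_le_sum_abs)
  also have "\<dots> < d"
    using s' t' \<delta> by linarith
  finally show ?thesis
    using s' t' \<delta> by (intro that[of s' t']) auto
qed

lemma Delta2_subset_closure:
  assumes G: "AE s in lborel. s \<in> G" and "0 < T"
  shows "Delta2 T \<subseteq> closure (Delta2 T \<inter> G \<times> G)"
proof
  fix z
  assume z: "z \<in> Delta2 T"
  obtain s t where st: "z = (s, t)"
    by (cases z)
  show "z \<in> closure (Delta2 T \<inter> G \<times> G)"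
    unfolding closure_approachable
  proof (intro allI impI)
    fix d :: real
    assume d: "0 < d"
    show "\<exists>y\<in>Delta2 T \<inter> G \<times> G. dist y z < d"
    proof (cases "s < t")
      case True
      obtain s' t' where "s' \<in> G" "t' \<in> G" "s \<le> s'" "s' < t'" "t' \<le> t" "dist (s', t') (s, t) < d"
        using Delta2_inner_approx[OF G True d] .
      then show ?thesis
        using z st by (intro bexI[of _ "(s', t')"]) (auto simp: Delta2_def)
    next
      \<comment> \<open>A diagonal point has no inner pairs; it is approximated by diagonal points
        over \<open>G\<close>.\<close>
      case False
      then have "s = t" "0 \<le> s" "s \<le> T"
        using z st by (auto simp: Delta2_def)
      moreover obtain s' where s': "max 0 (s - d / 2) < s'" "s' < min T (s + d / 2)" "s' \<in> G"
        using AE_lborel_dense[OF G, of "max 0 (s - d / 2)" "min T (s + d / 2)"] d \<open>0 < T\<close> calculation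
        by auto
      moreover have "dist (s', s') (s, s) \<le> \<bar>s' - s\<bar> + \<bar>s' - s\<bar>"
        unfolding dist_Pair_Pair dist_real_def by (rule order_trans[OF sqrt_sum_squares_le_sum_abs]) simp
      moreover have "\<bar>s' - s\<bar> + \<bar>s' - s\<bar> < d"
        using s' by linarith
      ultimately show ?thesis
        using st by (intro bexI[of _ "(s', s')"]) (auto simp: Delta2_def)
    qed
  qed
qed

text \<open>The hypothesis \<open>uc\<close> compares nested intervals only, which suffices for
  uniform continuity of each coordinate on a dense subset of the simplex. The last conclusion lets
  bounds over inner pairs pass to the extension.\<close>

lemma continuous_version:
  fixes A :: "real \<times> real \<Rightarrow> nat \<Rightarrow> real"
  assumes T: "0 < T" and G: "AE s in lborel. s \<in> G"
    and A: "A \<in> Delta2 T \<rightarrow> topspace (Euclidean_space m)"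
    and uc: "\<And>e. 0 < e \<Longrightarrow> \<exists>d>0. \<forall>s\<in>G. \<forall>t\<in>G. \<forall>s1\<in>G. \<forall>t1\<in>G. \<forall>i<m.
        0 \<le> s1 \<longrightarrow> s1 \<le> s \<longrightarrow> s \<le> t \<longrightarrow> t \<le> t1 \<longrightarrow> t1 \<le> T \<longrightarrow> s - s1 < d \<longrightarrow> t1 - t < d \<longrightarrow>
        \<bar>A (s, t) i - A (s1, t1) i\<bar> \<le> e"
  obtains B where "continuous_map (top_of_set (Delta2 T)) (Euclidean_space m) B"
    and "\<And>z. z \<in> Delta2 T \<inter> G \<times> G \<Longrightarrow> B z = A z"
    and "\<And>s t C. 0 \<le> s \<Longrightarrow> s < t \<Longrightarrow> t \<le> T \<Longrightarrow>
      (\<And>s' t'. s' \<in> G \<Longrightarrow> t' \<in> G \<Longrightarrow> s \<le> s' \<Longrightarrow> s' < t' \<Longrightarrow> t' \<le> t \<Longrightarrow> vec_norm m (A (s', t')) \<le> C) \<Longrightarrow>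
      vec_norm m (B (s, t)) \<le> C"
proof -
  define X where "X = Delta2 T \<inter> G \<times> G"
  have "uniformly_continuous_on X (\<lambda>z. A z i)" if i: "i < m" for i
    unfolding uniformly_continuous_on_def
  proof (intro allI impI)
    fix e :: real
    assume "0 < e"
    then obtain d where d: "0 < d" and *: "\<forall>s\<in>G. \<forall>t\<in>G. \<forall>s1\<in>G. \<forall>t1\<in>G. \<forall>i<m.
        0 \<le> s1 \<longrightarrow> s1 \<le> s \<longrightarrow> s \<le> t \<longrightarrow> t \<le> t1 \<longrightarrow> t1 \<le> T \<longrightarrow> s - s1 < d \<longrightarrow> t1 - t < d \<longrightarrow>
        \<bar>A (s, t) i - A (s1, t1) i\<bar> \<le> e / 3"
      using uc[of "e / 3"] by auto
    show "\<exists>d>0. \<forall>x\<in>X. \<forall>x'\<in>X. dist x' x < d \<longrightarrow> dist (A x' i) (A x i) < e"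
    proof (intro exI[of _ d] conjI d ballI impI)
      fix x x'
      assume x: "x \<in> X" and x': "x' \<in> X" and "dist x' x < d"
      obtain s t where st: "x = (s, t)"
        by (cases x)
      obtain s' t' where st': "x' = (s', t')"
        by (cases x')
      have "\<bar>s' - s\<bar> < d" "\<bar>t' - t\<bar> < d"
        using \<open>dist x' x < d\<close> dist_fst_le[of x' x] dist_snd_le[of x' x]
        by (auto simp: st st' dist_real_def)
      \<comment> \<open>The smallest interval containing both again has its endpoints in
        \<open>G\<close>, so two nested comparisons of size \<open>e / 3\<close> are enough.\<close>
      have "min s s' \<in> G" "max t t' \<in> G"
        using x x' by (auto simp: X_def st st' min_def max_def)
      then have "\<bar>A (s, t) i - A (min s s', max t t') i\<bar> \<le> e / 3"
        "\<bar>A (s', t') i - A (min s s', max t t') i\<bar> \<le> e / 3"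
        using * x x' i \<open>\<bar>s' - s\<bar> < d\<close> \<open>\<bar>t' - t\<bar> < d\<close> by (auto simp: X_def st st' Delta2_def)
      then show "dist (A x' i) (A x i) < e"
        using \<open>0 < e\<close> unfolding st st' dist_real_def by linarith
    qed
  qed
  then have "\<exists>g. \<forall>i<m. uniformly_continuous_on (closure X) (g i) \<and> (\<forall>x\<in>X. A x i = g i x)"
    by (intro choice) (metis uniformly_continuous_on_extension_on_closure)
  then obtain g where "\<forall>i<m. uniformly_continuous_on (closure X) (g i) \<and> (\<forall>x\<in>X. A x i = g i x)"
    by blast
  then have g: "\<And>i. i < m \<Longrightarrow> uniformly_continuous_on (closure X) (g i)"
    "\<And>i x. i < m \<Longrightarrow> x \<in> X \<Longrightarrow> g i x = A x i"
    by auto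
  \<comment> \<open>The zero entries keep the values in \<open>Euclidean_space m\<close> and agree
    with those of \<open>A\<close>.\<close>
  define B where "B z i = (if i < m then g i z else 0)" for z i
  have contB: "continuous_on (Delta2 T) (\<lambda>z. B z i)" for i
  proof (cases "i < m")
    case True
    then show ?thesis
      using g(1)[OF True, THEN uniformly_continuous_imp_continuous] Delta2_subset_closure[OF G T]
      by (auto simp: B_def X_def intro: continuous_on_subset)
  qed (simp add: B_def)
  have "continuous_map (top_of_set (Delta2 T)) (Euclidean_space m) B"
    unfolding Euclidean_space_def continuous_map_in_subtopology continuous_map_componentwise_UNIV
    using contB by (intro conjI allI) (simp, auto simp: B_def)
  moreover have BA: "B z = A z" if "z \<in> Delta2 T \<inter> G \<times> G" for z
  proof
    fix i
    have "A z \<in> topspace (Euclidean_space m)"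
      using A that by auto
    then show "B z i = A z i"
      using g(2)[of i z] that by (auto simp: B_def X_def topspace_Euclidean_space)
  qed
  moreover have "vec_norm m (B (s, t)) \<le> C"
    if st: "0 \<le> s" "s < t" "t \<le> T"
      and C: "\<And>s' t'. s' \<in> G \<Longrightarrow> t' \<in> G \<Longrightarrow> s \<le> s' \<Longrightarrow> s' < t' \<Longrightarrow> t' \<le> t \<Longrightarrow> vec_norm m (A (s', t')) \<le> C"
    for s t C
  \<comment> \<open>By continuity the norm of \<open>B\<close> would still exceed \<open>C\<close>
    at a nearby inner pair over \<open>G\<close>, where \<open>B\<close> equals
    \<open>A\<close>.\<close>
  proof (rule ccontr)
    assume "\<not> vec_norm m (B (s, t)) \<le> C"
    have "continuous_on (Delta2 T) (\<lambda>z. vec_norm m (B z))"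
      unfolding vec_norm_def L2_set_def by (intro continuous_intros contB)
    moreover have "(s, t) \<in> Delta2 T"
      using st by (auto simp: Delta2_def)
    ultimately obtain d where d: "0 < d" "\<And>z. z \<in> Delta2 T \<Longrightarrow> dist z (s, t) < d \<Longrightarrow>
        dist (vec_norm m (B z)) (vec_norm m (B (s, t))) < vec_norm m (B (s, t)) - C"
      using \<open>\<not> vec_norm m (B (s, t)) \<le> C\<close> unfolding continuous_on_iff
      by (metis diff_gt_0_iff_gt not_le)
    obtain s' t' where st': "s' \<in> G" "t' \<in> G" "s \<le> s'" "s' < t'" "t' \<le> t" "dist (s', t') (s, t) < d"
      using Delta2_inner_approx[OF G st(2) d(1)] .
    then have "(s', t') \<in> Delta2 T \<inter> G \<times> G"
      using st by (auto simp: Delta2_def)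
    then show False
      using d(2)[of "(s', t')"] st' C[of s' t'] BA[of "(s', t')"] by (auto simp: dist_real_def)
  qed
  ultimately show ?thesis
    using that by blast
qed

subsection \<open>Existence of the version\<close>

locale besov_data =
  fixes p q :: ennreal and K \<theta> D :: real and m :: nat and T M b :: real
    and \<omega> :: "real \<Rightarrow> real" and A :: "real \<times> real \<Rightarrow> nat \<Rightarrow> real"
  assumes p: "0 < p" and q: "0 < q" and K: "0 < K" and \<theta>: "0 < \<theta>" "\<theta> < 1" and D: "0 < D"
    and T: "0 < T" and M: "0 < M"
    and A_space: "A \<in> Delta2 T \<rightarrow> topspace (Euclidean_space m)"
    and A_meas: "A \<in> borel_measurable (restrict_space borel (Delta2 T))"
    and \<omega>_nonneg: "\<forall>r\<ge>0. 0 \<le> \<omega> r" and \<omega>_mono: "mono_on {0..} \<omega>"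
    and doubling: "\<forall>\<tau>>0. \<omega> (2 * \<tau>) \<le> D * \<omega> \<tau>"
    and dini: "\<forall>S>0. (\<integral>\<^sup>+h\<in>{0<..S}. ennreal (zeta p \<omega> h / h) \<partial>lborel) \<le> ennreal (K * zeta p \<omega> S)"
    and besov: "besov_qnorm m T p q \<omega> A = ennreal b" and b: "0 \<le> b"
    and delta_bound: "\<forall>s u t. 0 \<le> s \<and> s \<le> u \<and> u \<le> t \<and> t \<le> T \<longrightarrow>
          vec_norm m (delta A s u t)
            \<le> M * zeta p \<omega> (min (u - s) (t - u) powr \<theta> * max (u - s) (t - u) powr (1 - \<theta>))
                  powr enn2real (max 1 (1 / p))"
begin

section \<open>Reduction of the data to an almost subadditive function\<close>

definition c :: real where
  "c = dini_const p K powr enn2real (max 1 (1 / p))"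

text \<open>Dominates both the constant of the defect of additivity and that of the weak-type bound
  with \<epsilon> = 1/128, so that a single \<Phi> serves both.\<close>

definition \<kappa> :: real where
  "\<kappa> = c + 128 powr enn2real (1 / p) * (D * 2 powr enn2real (1 / q))"

definition \<Phi> :: "real \<Rightarrow> real" where
  "\<Phi> \<tau> = \<kappa> * (b + M) * weight p \<omega> \<tau>"

definition a :: "real \<times> real \<Rightarrow> real" where
  "a z = (if z \<in> Delta2 T then vec_norm m (A z) else 0)"

lemmas \<omega>_facts = p K \<omega>_nonneg \<omega>_mono dini

lemma c_pos: "0 < c"
  using dini_const_pos[OF \<omega>_facts] by (simp add: c_def)

lemma weight_mono: "0 < x \<Longrightarrow> x \<le> y \<Longrightarrow> weight p \<omega> x \<le> c * weight p \<omega> y"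
  unfolding c_def by (rule weight_almost_mono[OF \<omega>_facts])

lemma weight_nonneg': "0 < \<tau> \<Longrightarrow> 0 \<le> weight p \<omega> \<tau>"
  by (rule weight_nonneg[OF \<omega>_facts])

lemma \<kappa>_ge: "c \<le> \<kappa>" "128 powr enn2real (1 / p) * (D * 2 powr enn2real (1 / q)) \<le> \<kappa>" "0 < \<kappa>"
  using c_pos D by (auto simp: \<kappa>_def intro: add_pos_nonneg)

text \<open>Along \<open>1 / 2 ^ n\<close> the weights are the terms of a convergent series, and
  almost monotonicity covers the points in between.\<close>

lemma weight_small:
  assumes "0 < e"
  obtains y where "0 < y" "\<And>x. 0 < x \<Longrightarrow> x \<le> y \<Longrightarrow> weight p \<omega> x < e"
proof -
  have "summable (\<lambda>n. weight p \<omega> (1 / 2 ^ n))"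
  proof (rule bounded_imp_summable)
    show "(\<Sum>k\<le>n. weight p \<omega> (1 / 2 ^ k)) \<le> c * weight p \<omega> 1" for n
      using sum_weight_le[OF \<omega>_facts, of 1 "Suc n"] by (simp only: c_def lessThan_Suc_atMost)
  qed (simp add: weight_nonneg')
  then have "(\<lambda>n. weight p \<omega> (1 / 2 ^ n)) \<longlonglongrightarrow> 0"
    by (rule summable_LIMSEQ_zero)
  then have "\<forall>\<^sub>F n in sequentially. weight p \<omega> (1 / 2 ^ n) < e / c"
    using assms c_pos by (intro order_tendstoD(2)) auto
  then obtain n where n: "weight p \<omega> (1 / 2 ^ n) < e / c"
    by (auto simp: eventually_sequentially)
  show ?thesis
  proof (rule that[of "1 / 2 ^ n"])
    fix x :: real
    assume "0 < x" "x \<le> 1 / 2 ^ n"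
    then have "weight p \<omega> x \<le> c * weight p \<omega> (1 / 2 ^ n)"
      by (rule weight_mono)
    also have "\<dots> < e"
      using n c_pos by (simp add: field_simps)
    finally show "weight p \<omega> x < e" .
  qed simp
qed

lemma delta_le:
  assumes "0 \<le> s" "s \<le> u" "u \<le> t" "t \<le> T" and "0 < y"
    and y: "min (u - s) (t - u) powr \<theta> * max (u - s) (t - u) powr (1 - \<theta>) \<le> y"
  shows "vec_norm m (delta A s u t) \<le> M * (c * weight p \<omega> y)"
proof -
  define x where "x = min (u - s) (t - u) powr \<theta> * max (u - s) (t - u) powr (1 - \<theta>)"
  have "vec_norm m (delta A s u t) \<le> M * zeta p \<omega> x powr enn2real (max 1 (1 / p))"
    unfolding x_def using delta_bound assms by blast
  also have "\<dots> \<le> M * (c * weight p \<omega> y)"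
  proof (intro mult_left_mono)
    show "zeta p \<omega> x powr enn2real (max 1 (1 / p)) \<le> c * weight p \<omega> y"
    proof (cases "x = 0")
      \<comment> \<open>The degenerate case \<open>u = s\<close> or \<open>u = t\<close>, where
        \<open>zeta p \<omega> 0 = 0\<close> by convention.\<close>
      case True
      then show ?thesis
        using c_pos weight_nonneg'[OF \<open>0 < y\<close>] by (simp add: zeta_def)
    next
      case False
      then have "0 < x"
        by (simp add: x_def less_le)
      then show ?thesis
        using y zeta_powr[OF \<omega>_facts] weight_mono[of x y] by (simp add: x_def)
    qed
  qed (use M in simp)
  finally show ?thesis .
qed

lemma geometric_mean_le:
  assumes "s \<le> u" "u \<le> t" "s < t"
  shows "min (u - s) (t - u) powr \<theta> * max (u - s) (t - u) powr (1 - \<theta>) \<le> t - s"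
proof -
  have "min (u - s) (t - u) powr \<theta> * max (u - s) (t - u) powr (1 - \<theta>)
      \<le> (t - s) powr \<theta> * (t - s) powr (1 - \<theta>)"
    using assms \<theta> by (intro mult_mono powr_mono2) auto
  also have "\<dots> = t - s"
    using assms by (simp add: powr_add[symmetric])
  finally show ?thesis .
qed

text \<open>The increment \<open>delta A s s s\<close> is the negative of \<open>A (s, s)\<close>,
  and its bound involves \<open>zeta p \<omega> 0 = 0\<close>.\<close>

lemma A_diag:
  assumes "0 \<le> s" "s \<le> T"
  shows "vec_norm m (A (s, s)) = 0"
proof -
  have "vec_norm m (A (s, s)) = vec_norm m (delta A s s s)"
    by (simp add: vec_norm_def delta_def L2_set_def)
  also have "\<dots> \<le> 0"
    using delta_bound[rule_format, of s s s] assms by (simp add: zeta_def)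
  finally show ?thesis
    using vec_norm_nonneg[of m "A (s, s)"] by simp
qed

lemma a_measurable: "a \<in> borel_measurable borel"
proof -
  have coord: "(\<lambda>x :: nat \<Rightarrow> real. x i) \<in> borel_measurable borel" for i
    by (intro borel_measurable_continuous_onI continuous_on_product_coordinates)
  have [measurable]: "(\<lambda>z. A z i) \<in> borel_measurable (restrict_space borel (Delta2 T))" for i
    using A_meas coord by (rule measurable_compose)
  have "(\<lambda>z. vec_norm m (A z)) \<in> borel_measurable (restrict_space borel (Delta2 T))"
    unfolding vec_norm_def L2_set_def by measurable
  then have "(\<lambda>z. if z \<in> Delta2 T then vec_norm m (A z) else 0) \<in> borel_measurable borel"
    using closed_Delta2[of T] by (subst measurable_If_restrict_space_iff) auto
  then show ?thesis
    unfolding a_def[abs_def] .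
qed

text \<open>\<open>Omega_le\<close> bounds the quasinorm of each increment function with
  \<open>0 \<le> h \<le> \<tau>\<close>, and the weak-type inequality with \<epsilon> = 1/128 turns
  this into a measure bound at a level below \<Phi> \<tau>. For \<open>h < 0\<close> the function
  \<open>a\<close> vanishes.\<close>

lemma weak_bound:
  assumes \<tau>: "0 < \<tau>" "\<tau> \<le> T / 2" and "h \<le> \<tau>"
  shows "emeasure lborel {r. \<Phi> \<tau> < a (r, r + h)} \<le> ennreal (\<tau> / 128)"
proof (cases "0 \<le> h")
  case False
  then have "a (r, r + h) = 0" for r
    by (auto simp: a_def Delta2_def)
  then show ?thesis
    using weight_nonneg'[OF \<tau>(1)] \<kappa>_ge b M by (simp add: \<Phi>_def not_less[symmetric] mult_less_0_iff)
next
  case True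
  define R where "R = D * 2 powr enn2real (1 / q) * b * \<omega> \<tau>"
  have "0 \<le> \<omega> \<tau>"
    using \<omega>_nonneg \<tau> by simp
  then have R: "0 \<le> R"
    using D b by (simp add: R_def)
  define N where "N = restrict_space lborel {0..T - h}"
  have h: "h \<in> {0..\<tau>}"
    using True assms by simp
  have space: "space N = {0..T - h}"
    by (simp add: N_def space_restrict_space)
  have a_eq: "a (r, r + h) = vec_norm m (A (r, r + h))" if "r \<in> {0..T - h}" for r
    using that True by (simp add: a_def Delta2_def)
  have "(\<lambda>r. a (r, r + h)) \<in> borel_measurable borel"
    by (intro measurable_compose[OF _ a_measurable]) measurable
  then have "(\<lambda>r. a (r, r + h)) \<in> borel_measurable N"
    unfolding N_def by (intro measurable_restrict_space1) simp
  then have f: "(\<lambda>r. vec_norm m (A (r, r + h))) \<in> borel_measurable N"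
    by (rule measurable_cong[THEN iffD1, rotated]) (auto simp: space a_eq)
  have "Lp_qnorm p N (\<lambda>r. ennreal (vec_norm m (A (r, r + h)))) \<le> Omega m T p A \<tau>"
    unfolding N_def Omega_def using h by (intro SUP_upper)
  also have "\<dots> \<le> ennreal R"
    unfolding R_def using doubling \<tau> \<open>0 \<le> \<omega> \<tau>\<close>
    by (intro Omega_le q D \<omega>_mono besov b) auto
  finally have "emeasure N {r \<in> space N. (1 / (1 / 128)) powr enn2real (1 / p) * R * \<tau> powr (- enn2real (1 / p))
      < vec_norm m (A (r, r + h))} \<le> ennreal (1 / 128 * \<tau>)"
    using \<tau> by (intro Lp_qnorm_weak_type p f R vec_norm_nonneg) auto
  moreover define S where "S = {r \<in> space N. (1 / (1 / 128)) powr enn2real (1 / p) * R * \<tau> powr (- enn2real (1 / p))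
      < vec_norm m (A (r, r + h))}"
  moreover have "emeasure lborel {r. \<Phi> \<tau> < a (r, r + h)} \<le> emeasure N S"
  proof -
    have "(128 powr enn2real (1 / p) * (D * 2 powr enn2real (1 / q))) * b * weight p \<omega> \<tau>
        \<le> \<kappa> * (b + M) * weight p \<omega> \<tau>"
      using \<kappa>_ge b M weight_nonneg'[OF \<tau>(1)] D by (intro mult_right_mono mult_mono) auto
    then have *: "128 powr enn2real (1 / p) * R * \<tau> powr (- enn2real (1 / p)) \<le> \<Phi> \<tau>"
      by (simp add: \<Phi>_def R_def weight_def mult_ac)
    have \<Phi>: "0 \<le> \<Phi> \<tau>"
      using \<kappa>_ge b M weight_nonneg'[OF \<tau>(1)] by (simp add: \<Phi>_def)
    have "{r. \<Phi> \<tau> < a (r, r + h)} \<subseteq> S"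
      unfolding S_def
    proof safe
      fix r
      assume r: "\<Phi> \<tau> < a (r, r + h)"
      then have "(r, r + h) \<in> Delta2 T"
        using \<Phi> by (auto simp: a_def split: if_splits)
      then have "r \<in> {0..T - h}"
        by (auto simp: Delta2_def)
      then show "r \<in> space N" "(1 / (1 / 128)) powr enn2real (1 / p) * R * \<tau> powr (- enn2real (1 / p))
          < vec_norm m (A (r, r + h))"
        using r * a_eq by (auto simp: space)
    qed
    moreover have "S \<in> sets N"
      unfolding S_def using f by measurable
    then have "S \<in> sets lborel"
      by (auto simp: N_def sets_restrict_space_iff)
    moreover have "emeasure N S = emeasure lborel S"
      unfolding N_def by (rule emeasure_restrict_space) (auto simp: S_def space)
    ultimately show ?thesis
      using emeasure_mono[of _ S lborel] by auto
  qed
  ultimately show ?thesis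
    by (auto intro: order_trans)
qed

lemma almost_subadditive: "almost_subadditive a \<Phi> T (T / 2) c"
proof
  show "a (s, t) \<le> a (s, u) + a (u, t) + \<Phi> (t - s)"
    if "0 \<le> s" "s \<le> u" "u \<le> t" "t \<le> T" "s < t" for s u t
  proof -
    have "vec_norm m (delta A s u t) \<le> M * (c * weight p \<omega> (t - s))"
      using that by (intro delta_le geometric_mean_le) auto
    also have "\<dots> = c * M * weight p \<omega> (t - s)"
      by simp
    also have "\<dots> \<le> \<Phi> (t - s)"
      unfolding \<Phi>_def using \<kappa>_ge c_pos b M that
      by (intro mult_right_mono mult_mono weight_nonneg') auto
    finally show ?thesis
      using vec_norm_delta_triangle[of m A s t u] that by (simp add: a_def Delta2_def)
  qed
  show "\<Phi> x \<le> c * \<Phi> y" if "0 < x" "x \<le> y" for x y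
    using mult_left_mono[OF weight_mono[OF that], of "\<kappa> * (b + M)"] \<kappa>_ge b M
    by (simp add: \<Phi>_def mult_ac)
  show "(\<Sum>n<N. \<Phi> (\<tau> / 2 ^ n)) \<le> c * \<Phi> \<tau>" if "0 < \<tau>" for \<tau> N
    using mult_left_mono[OF sum_weight_le[OF \<omega>_facts that, folded c_def, of N], of "\<kappa> * (b + M)"] \<kappa>_ge b M
    by (simp add: \<Phi>_def sum_distrib_left mult_ac)
  show "0 \<le> \<Phi> \<tau>" if "0 < \<tau>" for \<tau>
    using weight_nonneg'[OF that] \<kappa>_ge b M by (simp add: \<Phi>_def)
qed (use T c_pos a_measurable weak_bound in \<open>auto simp: a_def\<close>)

text \<open>\<open>A (s1, t1) - A (s, t)\<close> is the sum of \<open>A (s1, s)\<close>,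
  \<open>A (t, t1)\<close>, \<open>delta A s1 s t\<close> and \<open>delta A s1 t t1\<close>. The
  first two are increments over short intervals; in the last two one of the subintervals is short,
  which makes the geometric mean small because \<theta> > 0.\<close>

lemma uniform_bound_imp_modulus:
  assumes C: "0 < C"
    and bound: "\<And>s t. s \<in> G \<Longrightarrow> t \<in> G \<Longrightarrow> 0 \<le> s \<Longrightarrow> s < t \<Longrightarrow> t \<le> T \<Longrightarrow>
      vec_norm m (A (s, t)) \<le> C * weight p \<omega> (t - s)"
    and e: "0 < e"
  shows "\<exists>d>0. \<forall>s\<in>G. \<forall>t\<in>G. \<forall>s1\<in>G. \<forall>t1\<in>G. \<forall>i<m.
        0 \<le> s1 \<longrightarrow> s1 \<le> s \<longrightarrow> s \<le> t \<longrightarrow> t \<le> t1 \<longrightarrow> t1 \<le> T \<longrightarrow> s - s1 < d \<longrightarrow> t1 - t < d \<longrightarrow>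
        \<bar>A (s, t) i - A (s1, t1) i\<bar> \<le> e"
proof -
  define S where "S = C + M * c"
  define e' where "e' = e / 2 / S"
  have pos: "0 < S"
    unfolding S_def using C M c_pos by (simp add: add_pos_pos)
  then have "0 < e'"
    using e by (simp add: e'_def)
  obtain y where y: "0 < y" "\<And>x. 0 < x \<Longrightarrow> x \<le> y \<Longrightarrow> weight p \<omega> x < e'"
    using weight_small[OF \<open>0 < e'\<close>] by blast
  \<comment> \<open>The second entry solves d^\<theta> T^(1-\<theta>) = y.\<close>
  define d where "d = min y ((y / T powr (1 - \<theta>)) powr (1 / \<theta>))"
  have d: "0 < d" "d \<le> y"
    using y T by (auto simp: d_def)
  have small: "x powr \<theta> * z powr (1 - \<theta>) \<le> y" if "0 \<le> x" "x \<le> d" "0 \<le> z" "z \<le> T" for x z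
  proof -
    have "x powr \<theta> * z powr (1 - \<theta>) \<le> ((y / T powr (1 - \<theta>)) powr (1 / \<theta>)) powr \<theta> * T powr (1 - \<theta>)"
      using that \<theta> by (intro mult_mono powr_mono2) (auto simp: d_def)
    also have "\<dots> = y"
      using \<theta> T y by (simp add: powr_powr)
    finally show ?thesis .
  qed
  have del: "vec_norm m (delta A s u t) \<le> M * c * e'"
    if "0 \<le> s" "s \<le> u" "u \<le> t" "t \<le> T" "min (u - s) (t - u) \<le> d" for s u t
  proof -
    have "vec_norm m (delta A s u t) \<le> M * (c * weight p \<omega> y)"
      using that y by (intro delta_le small) auto
    also have "\<dots> \<le> M * (c * e')"
      using M c_pos y(2)[OF y(1)] by (intro mult_left_mono) auto
    finally show ?thesis
      by simp
  qed
  have inc: "vec_norm m (A (s, t)) \<le> C * e'"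
    if "s \<in> G" "t \<in> G" "0 \<le> s" "s \<le> t" "t \<le> T" "t - s < d" for s t
  proof (cases "s = t")
    case True
    then show ?thesis
      using A_diag[of s] that C \<open>0 < e'\<close> by simp
  next
    case False
    then have "vec_norm m (A (s, t)) \<le> C * weight p \<omega> (t - s)"
      using that by (intro bound) auto
    also have "\<dots> \<le> C * e'"
      using y(2)[of "t - s"] that False d C by (intro mult_left_mono) auto
    finally show ?thesis .
  qed
  have half: "C * e' + M * c * e' = e / 2"
  proof -
    have "S * e' = e / 2"
      using pos unfolding e'_def by simp
    then show ?thesis
      by (simp add: S_def distrib_right)
  qed
  show ?thesis
  proof (intro exI[of _ d] conjI d ballI allI impI)
    fix s t s1 t1 i
    assume G: "s \<in> G" "t \<in> G" "s1 \<in> G" "t1 \<in> G" and i: "i < m"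
      and *: "0 \<le> s1" "s1 \<le> s" "s \<le> t" "t \<le> t1" "t1 \<le> T" "s - s1 < d" "t1 - t < d"
    have "\<bar>A (s1, s) i\<bar> \<le> C * e'"
      using G * by (intro order_trans[OF abs_le_vec_norm[OF i] inc]) auto
    moreover have "\<bar>A (t, t1) i\<bar> \<le> C * e'"
      using G * by (intro order_trans[OF abs_le_vec_norm[OF i] inc]) auto
    moreover have "\<bar>delta A s1 s t i\<bar> \<le> M * c * e'"
      using * by (intro order_trans[OF abs_le_vec_norm[OF i] del]) auto
    moreover have "\<bar>delta A s1 t t1 i\<bar> \<le> M * c * e'"
      using * by (intro order_trans[OF abs_le_vec_norm[OF i] del]) auto
    ultimately show "\<bar>A (s, t) i - A (s1, t1) i\<bar> \<le> e"
      using half unfolding delta_def by linarith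
  qed
qed

definition C\<^sub>0 :: real where
  "C\<^sub>0 = (1 + 4 * c) * (2 * c + c\<^sup>2 + (2 * c + c\<^sup>2) * c + 1) * \<kappa>"

lemma C\<^sub>0_pos: "0 < C\<^sub>0"
  using c_pos \<kappa>_ge by (simp add: C\<^sub>0_def add_pos_pos)

lemma exists_version:
  "\<exists>B. continuous_map (top_of_set (Delta2 T)) (Euclidean_space m) B \<and>
     (AE z in lborel. z \<in> Delta2 T \<longrightarrow> B z = A z) \<and>
     (SUP (s, t)\<in>{(s, t). 0 \<le> s \<and> s < t \<and> t \<le> T}.
        ennreal (vec_norm m (B (s, t)))
          / ennreal (\<omega> (t - s) * (t - s) powr (- enn2real (1 / p))))
     \<le> ennreal (C\<^sub>0 * c) * (besov_qnorm m T p q \<omega> A + ennreal M)"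
proof -
  interpret S: almost_subadditive a \<Phi> T "T / 2" c
    by (rule almost_subadditive)
  obtain G where G: "AE s in lborel. s \<in> G" and aG: "\<forall>s\<in>G. \<forall>t\<in>G. 0 \<le> s \<longrightarrow> s < t \<longrightarrow> t \<le> T \<longrightarrow>
      a (s, t) \<le> (1 + 4 * c) * (2 * c + c\<^sup>2 + (2 * c + c\<^sup>2) * c + 1) * \<Phi> (t - s)"
    using S.AE_pair_bound by auto
  have bound: "vec_norm m (A (s, t)) \<le> C\<^sub>0 * (b + M) * weight p \<omega> (t - s)"
    if "s \<in> G" "t \<in> G" "0 \<le> s" "s < t" "t \<le> T" for s t
    using aG that by (force simp: a_def Delta2_def \<Phi>_def C\<^sub>0_def mult_ac)
  have "0 < C\<^sub>0 * (b + M)"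
    using C\<^sub>0_pos b M by simp
  then have modulus: "\<exists>d>0. \<forall>s\<in>G. \<forall>t\<in>G. \<forall>s1\<in>G. \<forall>t1\<in>G. \<forall>i<m.
        0 \<le> s1 \<longrightarrow> s1 \<le> s \<longrightarrow> s \<le> t \<longrightarrow> t \<le> t1 \<longrightarrow> t1 \<le> T \<longrightarrow> s - s1 < d \<longrightarrow> t1 - t < d \<longrightarrow>
        \<bar>A (s, t) i - A (s1, t1) i\<bar> \<le> e" if "0 < e" for e
    using bound that by (rule uniform_bound_imp_modulus)
  obtain B where B: "continuous_map (top_of_set (Delta2 T)) (Euclidean_space m) B"
    "\<And>z. z \<in> Delta2 T \<inter> G \<times> G \<Longrightarrow> B z = A z"
    "\<And>s t C. 0 \<le> s \<Longrightarrow> s < t \<Longrightarrow> t \<le> T \<Longrightarrow>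
      (\<And>s' t'. s' \<in> G \<Longrightarrow> t' \<in> G \<Longrightarrow> s \<le> s' \<Longrightarrow> s' < t' \<Longrightarrow> t' \<le> t \<Longrightarrow> vec_norm m (A (s', t')) \<le> C) \<Longrightarrow>
      vec_norm m (B (s, t)) \<le> C"
    by (rule continuous_version[OF T G A_space modulus]) blast+
  have "AE z in lborel. fst z \<in> G \<and> snd z \<in> G"
    using G by (rule AE_lborel_prod)
  then have "AE z in lborel. z \<in> Delta2 T \<longrightarrow> B z = A z"
    by eventually_elim (auto intro: B(2))
  moreover have "(SUP (s, t)\<in>{(s, t). 0 \<le> s \<and> s < t \<and> t \<le> T}.
        ennreal (vec_norm m (B (s, t)))
          / ennreal (\<omega> (t - s) * (t - s) powr (- enn2real (1 / p))))
     \<le> ennreal (C\<^sub>0 * c) * (besov_qnorm m T p q \<omega> A + ennreal M)"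
  proof (intro SUP_least, clarify)
    fix s t :: real
    assume st: "0 \<le> s" "s < t" "t \<le> T"
    define w where "w = weight p \<omega> (t - s)"
    have w: "0 \<le> w"
      using st by (simp add: w_def weight_nonneg')
    have "vec_norm m (B (s, t)) \<le> C\<^sub>0 * (b + M) * (c * w)"
    \<comment> \<open>Inner pairs have length at most \<open>t - s\<close>; almost monotonicity of
      the weight costs the extra factor \<open>c\<close>.\<close>
    proof (rule B(3)[OF st])
      fix s' t'
      assume *: "s' \<in> G" "t' \<in> G" "s \<le> s'" "s' < t'" "t' \<le> t"
      have "vec_norm m (A (s', t')) \<le> C\<^sub>0 * (b + M) * weight p \<omega> (t' - s')"
        using * st by (intro bound) auto
      also have "\<dots> \<le> C\<^sub>0 * (b + M) * (c * w)"
        unfolding w_def using * st C\<^sub>0_pos b M by (intro mult_left_mono weight_mono) auto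
      finally show "vec_norm m (A (s', t')) \<le> C\<^sub>0 * (b + M) * (c * w)" .
    qed
    then have le: "vec_norm m (B (s, t)) \<le> C\<^sub>0 * c * (b + M) * w"
      by (simp add: mult_ac)
    have "ennreal (vec_norm m (B (s, t))) / ennreal w \<le> ennreal (C\<^sub>0 * c * (b + M))"
    \<comment> \<open>If the weight vanishes, so does \<open>B (s, t)\<close>, and the quotient is 0
      / 0 = 0.\<close>
    proof (cases "w = 0")
      case True
      then show ?thesis
        using le vec_norm_nonneg[of m "B (s, t)"] by simp
    next
      case False
      then show ?thesis
        using le w by (simp add: divide_ennreal vec_norm_nonneg ennreal_leI pos_divide_le_eq)
    qed
    also have "\<dots> = ennreal (C\<^sub>0 * c) * (besov_qnorm m T p q \<omega> A + ennreal M)"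
      using C\<^sub>0_pos c_pos b M by (simp add: besov ennreal_mult)
    finally show "ennreal (vec_norm m (B (s, t)))
          / ennreal (\<omega> (t - s) * (t - s) powr (- enn2real (1 / p)))
        \<le> ennreal (C\<^sub>0 * c) * (besov_qnorm m T p q \<omega> A + ennreal M)"
      by (simp add: w_def weight_def)
  qed
  ultimately show ?thesis
    using B(1) by blast
qed

end

theorem proposition2p7:
  fixes p q :: ennreal and K \<theta> D :: real
  assumes "0 < p" and "0 < q" and "0 < K" and "0 < \<theta>" and "\<theta> \<le> 1/2" and "0 < D"
  shows "\<exists>C::real. 0 < C \<and>
    (\<forall>(m::nat) (T::real) (M::real) (\<omega>::real \<Rightarrow> real) (A::real \<times> real \<Rightarrow> nat \<Rightarrow> real).
       0 < T \<longrightarrow> 0 < M \<longrightarrow>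
       A \<in> Delta2 T \<rightarrow> topspace (Euclidean_space m) \<longrightarrow>
       A \<in> borel_measurable (restrict_space borel (Delta2 T)) \<longrightarrow>
       (\<forall>r\<ge>0. 0 \<le> \<omega> r) \<longrightarrow>
       mono_on {0..} \<omega> \<longrightarrow>
       (\<omega> \<longlongrightarrow> 0) (at_right 0) \<longrightarrow>
       (\<forall>\<tau>>0. \<omega> (2 * \<tau>) \<le> D * \<omega> \<tau>) \<longrightarrow>
       (\<forall>S>0. (\<integral>\<^sup>+h\<in>{0<..S}. ennreal (zeta p \<omega> h / h) \<partial>lborel) \<le> ennreal (K * zeta p \<omega> S)) \<longrightarrow>
       besov_qnorm m T p q \<omega> A < \<infinity> \<longrightarrow>
       (\<forall>s u t. 0 \<le> s \<and> s \<le> u \<and> u \<le> t \<and> t \<le> T \<longrightarrow>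
          vec_norm m (delta A s u t)
            \<le> M * zeta p \<omega> (min (u - s) (t - u) powr \<theta> * max (u - s) (t - u) powr (1 - \<theta>))
                  powr enn2real (max 1 (1 / p))) \<longrightarrow>
       (\<exists>B::real \<times> real \<Rightarrow> nat \<Rightarrow> real.
          continuous_map (top_of_set (Delta2 T)) (Euclidean_space m) B \<and>
          (AE z in lborel. z \<in> Delta2 T \<longrightarrow> B z = A z) \<and>
          (SUP (s, t)\<in>{(s, t). 0 \<le> s \<and> s < t \<and> t \<le> T}.
             ennreal (vec_norm m (B (s, t)))
               / ennreal (\<omega> (t - s) * (t - s) powr (- enn2real (1 / p))))
          \<le> ennreal C * (besov_qnorm m T p q \<omega> A + ennreal M)))"
proof -
  \<comment> \<open>The arguments are fixed before \<open>m\<close>, \<open>T\<close>,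
    \<open>M\<close>, \<omega> and \<open>A\<close>, so \<open>C\<close> is uniform in these. The
    maximum with 1 makes positivity evident outside the locale.\<close>
  define C where "C = max 1 (besov_data.C\<^sub>0 p q K D * besov_data.c p K)"
  have *: "\<exists>B. continuous_map (top_of_set (Delta2 T)) (Euclidean_space m) B \<and>
     (AE z in lborel. z \<in> Delta2 T \<longrightarrow> B z = A z) \<and>
     (SUP (s, t)\<in>{(s, t). 0 \<le> s \<and> s < t \<and> t \<le> T}.
        ennreal (vec_norm m (B (s, t)))
          / ennreal (\<omega> (t - s) * (t - s) powr (- enn2real (1 / p))))
     \<le> ennreal C * (besov_qnorm m T p q \<omega> A + ennreal M)"
    if "besov_data p q K \<theta> D m T M b \<omega> A" for m T M b \<omega> A
  proof -
    interpret besov_data p q K \<theta> D m T M b \<omega> A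
      by (rule that)
    have "ennreal (C\<^sub>0 * c) * (besov_qnorm m T p q \<omega> A + ennreal M)
        \<le> ennreal C * (besov_qnorm m T p q \<omega> A + ennreal M)"
      by (intro mult_right_mono ennreal_leI) (auto simp: C_def)
    then show ?thesis
      using exists_version by (meson order_trans)
  qed
  show ?thesis
  proof (intro exI[of _ C] conjI allI impI)
    show "0 < C"
      by (simp add: C_def)
  next
    fix m T M \<omega> A
    assume "0 < T" "0 < M" "A \<in> Delta2 T \<rightarrow> topspace (Euclidean_space m)"
      "A \<in> borel_measurable (restrict_space borel (Delta2 T))" "\<forall>r\<ge>0. 0 \<le> \<omega> r" "mono_on {0..} \<omega>"
      "\<forall>\<tau>>0. \<omega> (2 * \<tau>) \<le> D * \<omega> \<tau>"
      "\<forall>S>0. (\<integral>\<^sup>+h\<in>{0<..S}. ennreal (zeta p \<omega> h / h) \<partial>lborel) \<le> ennreal (K * zeta p \<omega> S)"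
      "besov_qnorm m T p q \<omega> A < \<infinity>"
      "\<forall>s u t. 0 \<le> s \<and> s \<le> u \<and> u \<le> t \<and> t \<le> T \<longrightarrow>
          vec_norm m (delta A s u t)
            \<le> M * zeta p \<omega> (min (u - s) (t - u) powr \<theta> * max (u - s) (t - u) powr (1 - \<theta>))
                  powr enn2real (max 1 (1 / p))"
    moreover obtain b where "besov_qnorm m T p q \<omega> A = ennreal b" "0 \<le> b"
      using \<open>besov_qnorm m T p q \<omega> A < \<infinity>\<close> by (cases "besov_qnorm m T p q \<omega> A") auto
    ultimately have "besov_data p q K \<theta> D m T M b \<omega> A"
      using assms by unfold_locales auto
    then show "\<exists>B. continuous_map (top_of_set (Delta2 T)) (Euclidean_space m) B \<and>
     (AE z in lborel. z \<in> Delta2 T \<longrightarrow> B z = A z) \<and>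
     (SUP (s, t)\<in>{(s, t). 0 \<le> s \<and> s < t \<and> t \<le> T}.
        ennreal (vec_norm m (B (s, t)))
          / ennreal (\<omega> (t - s) * (t - s) powr (- enn2real (1 / p))))
     \<le> ennreal C * (besov_qnorm m T p q \<omega> A + ennreal M)"
      by (rule *)
  qed
qed

end
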